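(* $\tau_{\rm csep}(\mathbb{E}^3)=8$, which can be achieved by a TS-packing of $8$ spherical caps of angular radius $\frac{\pi}{6}$ possessing octahedral symmetry in $\mathbb{S}^2$.
   Context: $\tau_{\rm csep}(\mathbb{E}^3)$, the centered separable kissing number of unit balls in Euclidean $3$-space $\mathbb{E}^3$, is the maximum cardinality of a packing $\mathcal{P}$ of unit balls (i.e. a family of unit balls with pairwise disjoint interiors), each touching (externally) the unit ball centered at the origin $\mathbf{o}$, such that any two unit balls of $\mathcal{P}$ can be separated by a plane passing through $\mathbf{o}$ which is disjoint from the interiors of all the unit balls of $\mathcal{P}$. $\mathbb{S}^2$ is the unit sphere centered at $\mathbf{o}$. A great circle is the intersection of $\mathbb{S}^2$ with a plane through $\mathbf{o}$. The (closed) spherical cap of center $\mathbf{x}\in\mathbb{S}^2$ and angular radius $r$ is $\{\mathbf{y}\in\mathbb{S}^2:\langle\mathbf{y},\mathbf{x}\rangle\ge\cos r\}$. A totally separable packing (TS-packing) of $\mathbb{S}^2$ is a family of spherical caps such that any two of its caps can be separated by a great circle (i.e. they lie in different closed hemispheres bounded by it) which is disjoint from the interior of each cap in the family. Central projection from $\mathbf{o}$ onto $\mathbb{S}^2$ shows that $\tau_{\rm csep}(\mathbb{E}^3)$ equals the maximum number of spherical caps of angular radius $\frac{\pi}{6}$ that form a TS-packing in $\mathbb{S}^2$; a unit ball touching the central unit ball corresponds to the cap of angular radius $\frac{\pi}{6}$ centered at the touching point. *)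

theory Defs
  imports "HOL-Analysis.Analysis"
begin

abbreviation S2 :: "(real^3) set" where
  "S2 \<equiv> sphere 0 1"

definition origin_plane :: "real^3 \<Rightarrow> (real^3) set" where
  "origin_plane n = {x. n \<bullet> x = 0}"

definition great_circle :: "real^3 \<Rightarrow> (real^3) set" where
  "great_circle n = S2 \<inter> origin_plane n"

text \<open>Here \<open>n\<close> is a normal vector of the plane. As \<open>-n\<close> is a normal vector of the same plane,
  fixing which set lies on which side loses nothing once \<open>n\<close> is existentially quantified.\<close>
definition separated_by :: "real^3 \<Rightarrow> (real^3) set \<Rightarrow> (real^3) set \<Rightarrow> bool" where
  "separated_by n A B \<longleftrightarrow> A \<subseteq> {x. n \<bullet> x \<ge> 0} \<and> B \<subseteq> {x. n \<bullet> x \<le> 0}"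

definition unit_ball :: "(real^3) set \<Rightarrow> bool" where
  "unit_ball B \<longleftrightarrow> (\<exists>c. B = cball c 1)"

definition touches_externally :: "(real^3) set \<Rightarrow> (real^3) set \<Rightarrow> bool" where
  "touches_externally A B \<longleftrightarrow> A \<inter> B \<noteq> {} \<and> interior A \<inter> interior B = {}"

definition centered_separable_packing :: "(real^3) set set \<Rightarrow> bool" where
  "centered_separable_packing P \<longleftrightarrow>
     (\<forall>B\<in>P. unit_ball B \<and> touches_externally B (cball 0 1)) \<and>
     (\<forall>A\<in>P. \<forall>B\<in>P. A \<noteq> B \<longrightarrow> interior A \<inter> interior B = {}) \<and>
     (\<forall>A\<in>P. \<forall>B\<in>P. A \<noteq> B \<longrightarrow>
        (\<exists>n. n \<noteq> 0 \<and> separated_by n A B \<and> (\<forall>C\<in>P. origin_plane n \<inter> interior C = {})))"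

definition ecard :: "'a set \<Rightarrow> enat" where
  "ecard A = (if finite A then enat (card A) else \<infinity>)"

text \<open>A supremum in \<^typ>\<open>enat\<close>: whenever it is finite, it is attained and hence a maximum, and
  infinite packings are not discarded.\<close>
definition tau_csep :: enat where
  "tau_csep = (SUP P \<in> {P. centered_separable_packing P}. ecard P)"

definition cap :: "real^3 \<Rightarrow> real \<Rightarrow> (real^3) set" where
  "cap x r = {y \<in> S2. y \<bullet> x \<ge> cos r}"

definition spherical_cap :: "real \<Rightarrow> (real^3) set \<Rightarrow> bool" where
  "spherical_cap r C \<longleftrightarrow> (\<exists>x\<in>S2. C = cap x r)"

text \<open>The interior of a cap is its interior relative to the sphere.\<close>
definition TS_packing :: "(real^3) set set \<Rightarrow> bool" where
  "TS_packing F \<longleftrightarrow>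
     (\<forall>C\<in>F. \<exists>r. 0 < r \<and> r < pi \<and> spherical_cap r C) \<and>
     (\<forall>A\<in>F. \<forall>B\<in>F. A \<noteq> B \<longrightarrow>
        (\<exists>n. n \<noteq> 0 \<and> separated_by n A B \<and>
             (\<forall>C\<in>F. great_circle n \<inter> (top_of_set S2 interior_of C) = {})))"

text \<open>Away from the origin, \<^const>\<open>sgn\<close> is the central projection onto the unit sphere.\<close>
definition central_projection :: "(real^3) set \<Rightarrow> (real^3) set" where
  "central_projection A = sgn ` A"

text \<open>Regular octahedra centered at the origin.\<close>
definition regular_octahedron :: "(real^3) set \<Rightarrow> bool" where
  "regular_octahedron Q \<longleftrightarrow>
     (\<exists>a b c. a \<noteq> 0 \<and> norm a = norm b \<and> norm b = norm c \<and>
        orthogonal a b \<and> orthogonal b c \<and> orthogonal c a \<and>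
        Q = convex hull {a, -a, b, -b, c, -c})"

text \<open>The symmetry group of the family is the full octahedral group (reflections included).\<close>
definition octahedral_symmetry :: "(real^3) set set \<Rightarrow> bool" where
  "octahedral_symmetry F \<longleftrightarrow>
     (\<exists>Q. regular_octahedron Q \<and>
        {T. orthogonal_transformation T \<and> (\<lambda>C. T ` C) ` F = F} =
        {T. orthogonal_transformation T \<and> T ` Q = Q})"

end

theory Submission
  imports Defs
begin

text \<open>
A unit ball touching the central one is centered at \<open>2u\<close> for a unit vector \<open>u\<close>, and a plane through the
origin with unit normal \<open>n\<close> misses its interior exactly when \<open>\<bar>n \<bullet> u\<bar> \<ge> 1/2\<close>. So a packing is a set of
directions \<open>u\<close> such that any two of them are told apart by the sign of \<open>n \<bullet> u\<close> for some unit \<open>n\<close>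
with \<open>\<bar>n \<bullet> w\<bar> \<ge> 1/2\<close> for every direction \<open>w\<close> of the packing.

The lower bound is the set of vertices of a cube with the three coordinate planes, since
\<open>1 / sqrt 3 > 1/2\<close>. The symmetries of the cube are those of the octahedron polar to it.

For the upper bound, suppose there are nine directions. Five of them lie on one side of one of the
planes, say with unit normal \<open>n\<^sub>1\<close>. Call them \<open>x\<^sub>1, x\<^sub>2, x\<^sub>3, x\<^sub>4, v\<close>. Three further normals
\<open>n\<^sub>2, n\<^sub>3, n\<^sub>4\<close> suffice to separate the four \<open>x\<^sub>j\<close> pairwise, so the eight vectors \<open>x\<^sub>j\<close> and \<open>-x\<^sub>j\<close> lie in eight
different cells of the arrangement of these four planes. Two arguments exclude this.

First, four vectors in space are linearly dependent. After replacing some normals by their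
negatives (call the results \<open>m\<^sub>i\<close>) and normalising, the dependency reads \<open>\<Sum>i. d\<^sub>i m\<^sub>i = 0\<close> with weights
\<open>d\<^sub>i \<ge> 0\<close> of sum \<open>1\<close>. If \<open>x\<close> is one of the eight vectors and \<open>A\<close> is the set of indices with \<open>m\<^sub>i \<bullet> x > 0\<close>,
then the products on the positive side are at most \<open>1\<close> and those on the negative side at most
\<open>-1/2\<close>, so \<open>A\<close> has weight at least \<open>1/3\<close> (\<open>weight_ge\<close>). Hence not all four singletons occur as
patterns \<open>A\<close>, and if \<open>{i}\<close>, \<open>{j}\<close> and \<open>{i, j}\<close> all occur, every estimate is an equality, which forces the two
other normals to coincide (\<open>normals_eq_of_three_cells\<close>). Then no patterns other than these three and
their complements can occur.

Second, suppose that three of the normals already realize all eight sign patterns. Then any two unit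
vectors in one of these eight cells are at distance less than \<open>1\<close> (\<open>shattered_cell_diameter\<close>). But
\<open>v\<close> shares its cell with some \<open>\<plusminus>x\<^sub>j\<close>, and a plane separates \<open>v\<close> from either of \<open>\<plusminus>x\<^sub>j\<close> (that of \<open>n\<^sub>1\<close> for the minus
sign), so their distance is at least \<open>1\<close>.

Up to complements there are seven possible patterns, the four singletons and the three partitions
into pairs, and at least four of them occur. A short count shows that one of these two situations
must then arise (\<open>no_eight_cells_of_four_normals\<close>).
\<close>

section \<open>Touching balls and their directions\<close>

lemma touching_unit_ball:
  assumes "unit_ball B" "touches_externally B (cball 0 1)"
  obtains u where "norm u = 1" "B = cball (2 *\<^sub>R u) 1"
proof -
  obtain c where B: "B = cball c 1" using assms(1) by (auto simp: unit_ball_def)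
  have "norm c \<ge> 2"
  proof (rule ccontr)
    assume "\<not> norm c \<ge> 2"
    moreover have "norm (c - (1/2) *\<^sub>R c) = norm ((1/2) *\<^sub>R c)"
      by (rule arg_cong[of _ _ norm]) (simp add: vec_eq_iff)
    ultimately have "(1/2) *\<^sub>R c \<in> ball c 1 \<inter> ball 0 1" by (simp add: dist_norm)
    then show False using assms(2) B by (auto simp: touches_externally_def)
  qed
  moreover have "norm c \<le> 2"
  proof -
    obtain x where "x \<in> B" "x \<in> cball 0 1" using assms(2) by (auto simp: touches_externally_def)
    then have "norm (c - x) \<le> 1" "norm x \<le> 1" using B by (auto simp: dist_norm)
    then show ?thesis using norm_triangle_ineq[of "c - x" x] by simp
  qed
  ultimately show ?thesis using that[of "(1/2) *\<^sub>R c"] B by simp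
qed

lemma touching_unit_ball_of_unit:
  assumes "norm u = 1"
  shows "unit_ball (cball (2 *\<^sub>R u) 1)" "touches_externally (cball (2 *\<^sub>R u) 1) (cball 0 1)"
proof -
  show "unit_ball (cball (2 *\<^sub>R u) 1)" by (auto simp: unit_ball_def)
  have "u \<in> cball (2 *\<^sub>R u) 1 \<inter> cball 0 1"
    using assms by (simp add: dist_norm scaleR_2)
  moreover have "ball (2 *\<^sub>R u) 1 \<inter> ball 0 1 = {}"
    using assms by (intro disjoint_ballI) simp
  ultimately show "touches_externally (cball (2 *\<^sub>R u) 1) (cball 0 1)"
    by (auto simp: touches_externally_def)
qed

text \<open>The distance from the center \<open>2u\<close> to the plane is \<open>2\<bar>n \<bullet> u\<bar>\<close>. If it is less than \<open>1\<close>, the orthogonal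
  projection of the center lies in both sets.\<close>
lemma origin_plane_avoids_ball:
  assumes "norm n = 1"
  shows "origin_plane n \<inter> ball (2 *\<^sub>R u) 1 = {} \<longleftrightarrow> \<bar>n \<bullet> u\<bar> \<ge> 1/2"
proof
  have nn: "n \<bullet> n = 1" using assms by (simp add: dot_square_norm)
  assume e: "origin_plane n \<inter> ball (2 *\<^sub>R u) 1 = {}"
  (* the foot of the perpendicular from the center to the plane *)
  let ?x = "2 *\<^sub>R u - (2 * (n \<bullet> u)) *\<^sub>R n"
  have "?x \<in> origin_plane n" using nn by (simp add: origin_plane_def inner_diff_right)
  then have "?x \<notin> ball (2 *\<^sub>R u) 1" using e by blast
  then show "\<bar>n \<bullet> u\<bar> \<ge> 1/2" using assms by (simp add: dist_norm)
next
  assume "\<bar>n \<bullet> u\<bar> \<ge> 1/2"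
  show "origin_plane n \<inter> ball (2 *\<^sub>R u) 1 = {}"
  proof (safe)
    fix x assume x: "x \<in> origin_plane n" "x \<in> ball (2 *\<^sub>R u) 1"
    have "\<bar>n \<bullet> (2 *\<^sub>R u - x)\<bar> \<le> norm (2 *\<^sub>R u - x)"
      using Cauchy_Schwarz_ineq2[of n] assms by simp
    also have "\<dots> < 1" using x(2) by (simp add: dist_norm)
    finally show "x \<in> {}" using x(1) \<open>\<bar>n \<bullet> u\<bar> \<ge> 1/2\<close>
      by (simp add: origin_plane_def inner_diff_right)
  qed
qed

lemma separated_by_scale:
  assumes "s > 0"
  shows "separated_by (s *\<^sub>R n) A B = separated_by n A B" "origin_plane (s *\<^sub>R n) = origin_plane n"
  using assms by (auto simp: separated_by_def origin_plane_def zero_le_mult_iff mult_le_0_iff)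

text \<open>The touching point \<open>u\<close> stands for the ball of center \<open>2u\<close>, and \<open>n\<close> for the plane with unit normal \<open>n\<close>.
  The bound \<open>1/2\<close> is the sine of the angular radius of the caps, the least distance that the touching
  point of a ball can have from a plane which avoids the interior of that ball.\<close>
definition separable_directions :: "(real^3) set \<Rightarrow> bool" where
  "separable_directions U \<longleftrightarrow> U \<subseteq> S2 \<and>
     (\<forall>u\<in>U. \<forall>v\<in>U. u \<noteq> v \<longrightarrow> (\<exists>n\<in>S2. n \<bullet> u \<ge> 1/2 \<and> n \<bullet> v \<le> - (1/2) \<and> (\<forall>w\<in>U. \<bar>n \<bullet> w\<bar> \<ge> 1/2)))"

lemma inj_cball: "inj_on (\<lambda>u. cball (2 *\<^sub>R u) 1) U" for U :: "(real^3) set"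
  by (auto simp: inj_on_def cball_eq_cball_iff)

lemma packing_directions:
  assumes P: "centered_separable_packing P"
  obtains U where "separable_directions U" "P = (\<lambda>u. cball (2 *\<^sub>R u) 1) ` U"
proof
  let ?b = "\<lambda>u::real^3. cball (2 *\<^sub>R u) 1"
  define U where "U = {u \<in> S2. ?b u \<in> P}"
  show PU: "P = ?b ` U"
  proof safe
    fix B assume "B \<in> P"
    then obtain u where "norm u = 1" "B = ?b u"
      using P touching_unit_ball[of B] unfolding centered_separable_packing_def by metis
    with \<open>B \<in> P\<close> show "B \<in> ?b ` U" by (auto simp: U_def)
  qed (auto simp: U_def)
  have sep: "\<And>A B. A \<in> P \<Longrightarrow> B \<in> P \<Longrightarrow> A \<noteq> B \<Longrightarrow>
      \<exists>n. n \<noteq> 0 \<and> separated_by n A B \<and> (\<forall>C\<in>P. origin_plane n \<inter> interior C = {})"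
    using P by (simp add: centered_separable_packing_def)
  show "separable_directions U"
    unfolding separable_directions_def
  proof (intro conjI ballI impI)
    show "U \<subseteq> S2" by (auto simp: U_def)
    fix u v assume uv: "u \<in> U" "v \<in> U" "u \<noteq> v"
    then have "?b u \<in> P" "?b v \<in> P" "?b u \<noteq> ?b v"
      by (auto simp: U_def cball_eq_cball_iff)
    then obtain n where n: "n \<noteq> 0" "separated_by n (?b u) (?b v)" "\<And>C. C \<in> P \<Longrightarrow> origin_plane n \<inter> interior C = {}"
      using sep[of "?b u" "?b v"] by blast
    define e where "e = sgn n"
    have e: "norm e = 1" "separated_by e (?b u) (?b v)" "origin_plane e = origin_plane n"
      using n separated_by_scale[of "inverse (norm n)" n] by (auto simp: e_def norm_sgn sgn_div_norm)
    have av: "\<bar>e \<bullet> w\<bar> \<ge> 1/2" if "w \<in> U" for w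
      using n(3)[of "?b w"] that origin_plane_avoids_ball[OF e(1), of w] e(3) by (auto simp: U_def)
    have "2 *\<^sub>R u \<in> ?b u" "2 *\<^sub>R v \<in> ?b v" by auto
    then have "e \<bullet> u \<ge> 0" "e \<bullet> v \<le> 0" using e(2) unfolding separated_by_def by fastforce+
    then show "\<exists>n\<in>S2. n \<bullet> u \<ge> 1/2 \<and> n \<bullet> v \<le> - (1/2) \<and> (\<forall>w\<in>U. \<bar>n \<bullet> w\<bar> \<ge> 1/2)"
      using e(1) av av[OF uv(1)] av[OF uv(2)] by (intro bexI[of _ e]) auto
  qed
qed

text \<open>Here the bound on \<open>n \<bullet> u\<close> gives more than a plane avoiding the interiors: since the plane leaves
  the balls on different sides, their interiors are disjoint as well.\<close>
lemma packing_of_directions: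
  assumes U: "separable_directions U"
  shows "centered_separable_packing ((\<lambda>u. cball (2 *\<^sub>R u) 1) ` U)" (is "centered_separable_packing (?b ` U)")
proof -
  have ball_side: "n \<bullet> x > 0" if "x \<in> ball (2 *\<^sub>R u) 1" "n \<in> S2" "n \<bullet> u \<ge> 1/2" for x n u :: "real^3"
  proof -
    have "n \<bullet> (2 *\<^sub>R u - x) \<le> norm (2 *\<^sub>R u - x)"
      using norm_cauchy_schwarz[of n] that(2) by simp
    also have "\<dots> < 1" using that(1) by (simp add: dist_norm)
    finally show ?thesis using that(3) by (simp add: inner_diff_right)
  qed
  have cball_side: "n \<bullet> x \<ge> 0" if "x \<in> ?b u" "n \<in> S2" "n \<bullet> u \<ge> 1/2" for x n u :: "real^3"
  proof -
    have "n \<bullet> (2 *\<^sub>R u - x) \<le> norm (2 *\<^sub>R u - x)"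
      using norm_cauchy_schwarz[of n] that(2) by simp
    also have "\<dots> \<le> 1" using that(1) by (simp add: dist_norm)
    finally show ?thesis using that(3) by (simp add: inner_diff_right)
  qed
  have sep: "\<exists>n. n \<noteq> 0 \<and> separated_by n (?b u) (?b v) \<and> (\<forall>C\<in>?b ` U. origin_plane n \<inter> interior C = {})
      \<and> interior (?b u) \<inter> interior (?b v) = {}"
    if uv: "u \<in> U" "v \<in> U" "u \<noteq> v" for u v
  proof -
    obtain n where n: "n \<in> S2" "n \<bullet> u \<ge> 1/2" "n \<bullet> v \<le> - (1/2)" "\<And>w. w \<in> U \<Longrightarrow> \<bar>n \<bullet> w\<bar> \<ge> 1/2"
      using U uv unfolding separable_directions_def by blast
    have n': "- n \<in> S2" "- n \<bullet> v \<ge> 1/2" using n by auto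
    have "separated_by n (?b u) (?b v)"
      using cball_side[OF _ n(1,2)] cball_side[OF _ n'] by (fastforce simp: separated_by_def)
    moreover have "interior (?b u) \<inter> interior (?b v) = {}"
      using ball_side[OF _ n(1,2)] ball_side[OF _ n'] by fastforce
    moreover have "origin_plane n \<inter> interior (?b w) = {}" if "w \<in> U" for w
      using origin_plane_avoids_ball[of n w] n(1) n(4)[OF that] by simp
    ultimately show ?thesis using n(1) by (intro exI[of _ n]) auto
  qed
  have "U \<subseteq> S2" using U by (simp add: separable_directions_def)
  then show ?thesis
    unfolding centered_separable_packing_def
  proof (intro conjI ballI impI)
    fix B assume "B \<in> ?b ` U"
    with \<open>U \<subseteq> S2\<close> show "unit_ball B" "touches_externally B (cball 0 1)"
      using touching_unit_ball_of_unit by auto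
  next
    fix A B assume "A \<in> ?b ` U" "B \<in> ?b ` U" "A \<noteq> B"
    then show "interior A \<inter> interior B = {}" using sep by blast
  next
    fix A B assume "A \<in> ?b ` U" "B \<in> ?b ` U" "A \<noteq> B"
    then show "\<exists>n. n \<noteq> 0 \<and> separated_by n A B \<and> (\<forall>C\<in>?b ` U. origin_plane n \<inter> interior C = {})"
      using sep by blast
  qed
qed

section \<open>A dependency between four normals\<close>

text \<open>Indexing by a type rather than by a set of vectors keeps the statement meaningful when some of the
  vectors coincide, which is not excluded when this is applied.\<close>
lemma exists_linear_dependency:
  fixes f :: "4 \<Rightarrow> real^3"
  shows "\<exists>c. c \<noteq> (\<lambda>_. 0) \<and> (\<Sum>i\<in>UNIV. c i *\<^sub>R f i) = 0"
proof -
  define g where "g c = (\<Sum>i\<in>UNIV. (c $ i) *\<^sub>R f i)" for c :: "real^4"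
  have lin: "linear g"
    by (rule linearI) (simp_all add: g_def scaleR_add_left sum.distrib scaleR_sum_right)
  have "\<not> inj g"
  proof
    assume "inj g"
    then have "dim (range g) = dim (UNIV :: (real^4) set)"
      by (intro dim_image_eq[OF lin]) (auto intro: inj_on_subset)
    moreover have "dim (range g) \<le> 3"
      using dim_subset_UNIV[of "range g"] by simp
    ultimately show False by simp
  qed
  then obtain c where "g c = 0" "c \<noteq> 0"
    using linear_injective_0[OF lin] by blast
  then show ?thesis
    by (intro exI[of _ "\<lambda>i. c $ i"]) (auto simp: g_def fun_eq_iff vec_eq_iff)
qed

text \<open>The set \<open>A\<close> encodes a sign pattern by its positive indices, so that passing to the antipode of \<open>x\<close>
  is taking complements.\<close>
definition realizes :: "(4 \<Rightarrow> real^3) \<Rightarrow> real^3 \<Rightarrow> 4 set \<Rightarrow> bool" where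
  "realizes m x A \<longleftrightarrow> norm x = 1 \<and>
     (\<forall>i. if i \<in> A then m i \<bullet> x \<ge> 1/2 else m i \<bullet> x \<le> - (1/2))"

lemma realizes_uminus: "realizes m (- x) (- A) \<longleftrightarrow> realizes m x A"
proof -
  have "(if i \<in> - A then m i \<bullet> - x \<ge> 1/2 else m i \<bullet> - x \<le> - (1/2)) \<longleftrightarrow>
      (if i \<in> A then m i \<bullet> x \<ge> 1/2 else m i \<bullet> x \<le> - (1/2))" for i
    by auto
  then show ?thesis by (simp only: realizes_def norm_minus_cancel)
qed

lemma realizes_in: "realizes m x A \<Longrightarrow> i \<in> A \<Longrightarrow> m i \<bullet> x \<ge> 1/2"
  and realizes_notin: "realizes m x A \<Longrightarrow> i \<notin> A \<Longrightarrow> m i \<bullet> x \<le> - (1/2)"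
  unfolding realizes_def by meson+

lemma unit_vectors_eq_of_inner:
  fixes x y :: "real^3"
  assumes "norm x = 1" "norm y = 1" "x \<bullet> y \<ge> 1"
  shows "x = y"
proof -
  have "x \<bullet> x = 1" "y \<bullet> y = 1" using assms by (auto simp: dot_square_norm)
  then have "(x - y) \<bullet> (x - y) \<le> 0"
    using assms(3) by (simp add: inner_diff_left inner_diff_right inner_commute)
  then show ?thesis
    by (metis inner_eq_zero_iff inner_ge_zero order_antisym eq_iff_diff_eq_0)
qed

lemma inner_unit_le:
  fixes x y :: "real^3"
  assumes "norm x = 1" "norm y = 1"
  shows "x \<bullet> y \<le> 1"
  using norm_cauchy_schwarz[of x y] assms by simp

context
  fixes m :: "4 \<Rightarrow> real^3" and d :: "4 \<Rightarrow> real"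
  assumes unit: "\<And>i. norm (m i) = 1"
    and d0: "\<And>i. d i \<ge> 0" and d1: "sum d UNIV = 1"
    and dep: "(\<Sum>i\<in>UNIV. d i *\<^sub>R m i) = 0"
begin

lemma weight_split: "sum d A + sum d (- A) = 1"
  using d1 sum.union_disjoint[of A "-A" d] by (simp add: Compl_partition)

text \<open>Take the inner product of the dependency with \<open>x\<close>. Outside \<open>A\<close> the products are at most \<open>-1/2\<close>, so
  those inside \<open>A\<close> must make up for half of the remaining weight. The left hand side measures how much
  they fall short of their maximum \<open>1\<close>, and it is kept because it has to vanish in the equality case.\<close>
lemma weight_slack:
  assumes "realizes m x A"
  shows "(\<Sum>i\<in>A. d i * (1 - m i \<bullet> x)) \<le> 3/2 * (sum d A - 1/3)"
proof -
  have "0 = (\<Sum>i\<in>UNIV. d i *\<^sub>R m i) \<bullet> x" by (simp add: dep)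
  also have "\<dots> = (\<Sum>i\<in>UNIV. d i * (m i \<bullet> x))" by (simp add: inner_sum_left)
  also have "\<dots> = (\<Sum>i\<in>A. d i * (m i \<bullet> x)) + (\<Sum>i\<in>-A. d i * (m i \<bullet> x))"
    using sum.union_disjoint[of A "-A" "\<lambda>i. d i * (m i \<bullet> x)"] by (simp add: Compl_partition)
  also have "(\<Sum>i\<in>-A. d i * (m i \<bullet> x)) \<le> (\<Sum>i\<in>-A. d i * - (1/2))"
    using assms d0 by (intro sum_mono mult_left_mono) (auto simp: realizes_def split: if_splits)
  also have "(\<Sum>i\<in>-A. d i * - (1/2)) = - (1/2) * sum d (-A)"
    by (simp only: sum_distrib_right[symmetric] mult.commute)
  finally show ?thesis using weight_split[of A]
    by (simp add: algebra_simps sum_subtractf)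
qed

lemma weight_ge:
  assumes "realizes m x A"
  shows "sum d A \<ge> 1/3"
proof -
  have "0 \<le> (\<Sum>i\<in>A. d i * (1 - m i \<bullet> x))"
    using assms d0 unit by (intro sum_nonneg mult_nonneg_nonneg) (auto simp: realizes_def inner_unit_le)
  with weight_slack[OF assms] show ?thesis by simp
qed

lemma normal_eq_point_of_tight:
  assumes r: "realizes m x A" and tight: "sum d A = 1/3" and i: "i \<in> A" "d i > 0"
  shows "m i = x"
proof -
  have x: "norm x = 1" using r by (simp add: realizes_def)
  have nn: "\<And>i. 0 \<le> d i * (1 - m i \<bullet> x)"
    using d0 unit x by (simp add: inner_unit_le)
  have "d i * (1 - m i \<bullet> x) \<le> (\<Sum>i\<in>A. d i * (1 - m i \<bullet> x))"
    using i nn by (intro member_le_sum) auto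
  also have "\<dots> \<le> 0" using weight_slack[OF r] tight by simp
  finally have "m i \<bullet> x \<ge> 1" using i by (simp add: mult_le_0_iff)
  then show ?thesis using unit x by (intro unit_vectors_eq_of_inner)
qed

text \<open>Both \<open>{i}\<close> and \<open>{j}\<close> have weight at least \<open>1/3\<close>, and so does \<open>{k, l}\<close>, which is the pattern of \<open>-z\<close>. So
  all three weights equal \<open>1/3\<close>, and every normal of positive weight is equal to the corresponding vector
  among \<open>x\<close>, \<open>y\<close>, \<open>-z\<close>. If \<open>k\<close> and \<open>l\<close> both have positive weight, then both normals are \<open>-z\<close>. Otherwise the
  dependency expresses one of them as \<open>-x-y\<close>, and the clearance of the other from \<open>x\<close> and \<open>y\<close> makes
  their inner product \<open>1\<close>.\<close>
lemma normals_eq_of_three_cells: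
  assumes ijkl: "distinct [i, j, k, l]" "UNIV = {i, j, k, l}"
    and r: "realizes m x {i}" "realizes m y {j}" "realizes m z {i, j}"
  shows "m k = m l"
proof -
  have di: "d i \<ge> 1/3" and dj: "d j \<ge> 1/3"
    using weight_ge[OF r(1)] weight_ge[OF r(2)] by auto
  have compl: "- {i, j} = {k, l}"
    using ijkl by auto
  have rz: "realizes m (- z) {k, l}"
    using r(3) realizes_uminus[of m z "{i, j}"] compl by simp
  have dkl: "d k + d l \<ge> 1/3" using weight_ge[OF rz] ijkl by simp
  have tot: "d i + d j + d k + d l = 1"
    using d1 ijkl(1) unfolding ijkl(2) by simp
  have eqs: "d i = 1/3" "d j = 1/3" "d k + d l = 1/3"
    using di dj dkl tot by auto
  have mi: "m i = x" and mj: "m j = y"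
    using normal_eq_point_of_tight[OF r(1), of i] normal_eq_point_of_tight[OF r(2), of j] eqs by auto
  have mk: "m k = - z" if "d k > 0"
    using normal_eq_point_of_tight[OF rz, of k] eqs ijkl that by auto
  have ml: "m l = - z" if "d l > 0"
    using normal_eq_point_of_tight[OF rz, of l] eqs ijkl that by auto
  have sum0: "d i *\<^sub>R m i + d j *\<^sub>R m j + d k *\<^sub>R m k + d l *\<^sub>R m l = 0"
    using dep ijkl(1) unfolding ijkl(2) by (simp add: add.assoc)
  have bounds: "m k \<bullet> x \<le> -(1/2)" "m k \<bullet> y \<le> -(1/2)" "m l \<bullet> x \<le> -(1/2)" "m l \<bullet> y \<le> -(1/2)"
    using r(1,2)[THEN realizes_notin] ijkl(1) by auto
  have last: "m p = m q"
    if "d p = 0" "d q = 1/3" "m p \<bullet> x \<le> -(1/2)" "m p \<bullet> y \<le> -(1/2)"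
      "d i *\<^sub>R m i + d j *\<^sub>R m j + d p *\<^sub>R m p + d q *\<^sub>R m q = 0" for p q
  proof -
    have "(1/3) *\<^sub>R (x + y + m q) = 0"
      using that(5) unfolding that(1,2) eqs(1,2) mi mj by (simp add: scaleR_add_right)
    then have "x + y + m q = 0" by simp
    then have "m q = - x - y" by (metis add.inverse_unique add.commute diff_conv_add_uminus minus_add_distrib)
    then have "m p \<bullet> m q \<ge> 1" using that(3,4) by (simp add: inner_diff_right)
    then show ?thesis using unit by (intro unit_vectors_eq_of_inner)
  qed
  consider "d k > 0" "d l > 0" | "d k = 0" | "d l = 0" using d0 by (metis order_le_less)
  then show ?thesis
  proof cases
    case 1 then show ?thesis using mk ml by simp
  next
    case 2
    then show ?thesis using eqs(3) bounds(1,2) sum0 by (intro last) simp_all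
  next
    case 3
    then have "m l = m k" using eqs(3) bounds(3,4) sum0 by (intro last) (simp_all add: add.assoc)
    then show ?thesis by simp
  qed
qed

end

section \<open>Three normals realizing all sign patterns\<close>

text \<open>Write \<open>w = u - v\<close> as \<open>\<Sum>i. a\<^sub>i m\<^sub>i\<close>, summing over the three normals, and let \<open>s = \<Sum>i. \<bar>a\<^sub>i\<bar>\<close>. As
  \<open>u\<close> and \<open>v\<close> lie in one cell, both \<open>m\<^sub>i \<bullet> u\<close> and \<open>m\<^sub>i \<bullet> v\<close> are in \<open>[1/2, 1]\<close> or both in
  \<open>[-1, -1/2]\<close>, so \<open>\<bar>m\<^sub>i \<bullet> w\<bar> \<le> 1/2\<close> and \<open>\<bar>w\<bar>\<^sup>2 \<le> s/2\<close>. On the other hand some unit vector \<open>x\<close>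
  realizes the signs of the coefficients, and \<open>\<bar>w\<bar> \<ge> w \<bullet> x \<ge> s/2\<close>. Together these give \<open>\<bar>w\<bar> \<le> 1\<close>.

  Equality would make all these estimates tight. If some coefficient is zero, two vectors from
  different cells both have to be \<open>w\<close>. If no coefficient is zero, each of the three normals is \<open>\<plusminus>u\<close> or
  \<open>\<plusminus>v\<close>, so two of them agree up to sign and cannot realize all sign patterns.\<close>
lemma shattered_cell_diameter:
  fixes m :: "4 \<Rightarrow> real^3"
  assumes unit: "\<And>i. norm (m i) = 1"
    and shattered: "\<And>B. \<exists>x. norm x = 1 \<and> (\<forall>i. i \<noteq> k \<longrightarrow>
          (if i \<in> B then m i \<bullet> x \<ge> 1/2 else m i \<bullet> x \<le> - (1/2)))"
    and uv: "norm u = 1" "norm v = 1"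
    and cell: "\<And>i. i \<noteq> k \<Longrightarrow> m i \<bullet> u \<ge> 1/2 \<and> m i \<bullet> v \<ge> 1/2 \<or>
                  m i \<bullet> u \<le> - (1/2) \<and> m i \<bullet> v \<le> - (1/2)"
  shows "norm (u - v) < 1"
proof (rule ccontr)
  define w where "w = u - v"
  assume "\<not> norm (u - v) < 1"
  then have w1: "norm w \<ge> 1" by (simp add: w_def)

  (* the sign pattern may be chosen freely at indices where the coefficient is zero *)
  have supp: "\<exists>x. norm x = 1 \<and> (\<forall>i. i \<noteq> k \<longrightarrow> (if i \<in> B then m i \<bullet> x \<ge> 1/2 else m i \<bullet> x \<le> - (1/2))) \<and>
      (\<Sum>i\<in>-{k}. c i *\<^sub>R m i) \<bullet> x \<ge> (\<Sum>i\<in>-{k}. \<bar>c i\<bar>) / 2"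
    if B: "\<And>i. i \<noteq> k \<Longrightarrow> c i > 0 \<Longrightarrow> i \<in> B" "\<And>i. i \<noteq> k \<Longrightarrow> c i < 0 \<Longrightarrow> i \<notin> B" for c :: "4 \<Rightarrow> real" and B
  proof -
    obtain x where x: "norm x = 1"
      "\<And>i. i \<noteq> k \<Longrightarrow> (if i \<in> B then m i \<bullet> x \<ge> 1/2 else m i \<bullet> x \<le> - (1/2))"
      using shattered[of B] by blast
    have "\<bar>c i\<bar> / 2 \<le> c i * (m i \<bullet> x)" if "i \<noteq> k" for i
    proof -
      consider "c i = 0" | "c i > 0" | "c i < 0" by linarith
      then show ?thesis
      proof cases
        case 2
        then show ?thesis
          using x(2)[OF that] B(1)[OF that] mult_left_mono[of "1/2" "m i \<bullet> x" "c i"] by simp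
      next
        case 3
        then show ?thesis
          using x(2)[OF that] B(2)[OF that] mult_left_mono_neg[of "m i \<bullet> x" "-(1/2)" "c i"] by simp
      qed auto
    qed
    then have "(\<Sum>i\<in>-{k}. \<bar>c i\<bar> / 2) \<le> (\<Sum>i\<in>-{k}. c i * (m i \<bullet> x))"
      by (intro sum_mono) simp
    then have "(\<Sum>i\<in>-{k}. c i *\<^sub>R m i) \<bullet> x \<ge> (\<Sum>i\<in>-{k}. \<bar>c i\<bar>) / 2"
      by (simp add: inner_sum_left sum_divide_distrib)
    then show ?thesis using x by blast
  qed

  (* index k is free, so it carries w in a dependency between w and the three normals *)
  obtain c where c: "c \<noteq> (\<lambda>_. 0)" "(\<Sum>i\<in>UNIV. c i *\<^sub>R (m(k := w)) i) = 0"
    using exists_linear_dependency by blast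
  have split: "c k *\<^sub>R w + (\<Sum>i\<in>-{k}. c i *\<^sub>R m i) = 0"
  proof -
    have "(\<Sum>i\<in>UNIV. c i *\<^sub>R (m(k := w)) i) = c k *\<^sub>R w + (\<Sum>i\<in>-{k}. c i *\<^sub>R (m(k := w)) i)"
      using sum.remove[of UNIV k "\<lambda>i. c i *\<^sub>R (m(k := w)) i"] by (simp add: Compl_eq_Diff_UNIV)
    also have "(\<Sum>i\<in>-{k}. c i *\<^sub>R (m(k := w)) i) = (\<Sum>i\<in>-{k}. c i *\<^sub>R m i)"
      by (rule sum.cong) auto
    finally show ?thesis using c(2) by simp
  qed
  have "c k \<noteq> 0"
  proof
    assume ck: "c k = 0"
    obtain x where "(\<Sum>i\<in>-{k}. c i *\<^sub>R m i) \<bullet> x \<ge> (\<Sum>i\<in>-{k}. \<bar>c i\<bar>) / 2"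
      using supp[of c "{i. c i > 0}"] by auto
    then have "(\<Sum>i\<in>-{k}. \<bar>c i\<bar>) \<le> 0" using split ck by simp
    then have "(\<Sum>i\<in>-{k}. \<bar>c i\<bar>) = 0" by (simp add: sum_nonneg order_antisym)
    then have "\<forall>i\<in>-{k}. \<bar>c i\<bar> = 0" by (subst (asm) sum_nonneg_eq_0_iff) auto
    with ck have "c = (\<lambda>_. 0)" by (auto simp: fun_eq_iff)
    with c(1) show False by simp
  qed
  define a where "a i = - c i / c k" for i
  have wa: "w = (\<Sum>i\<in>-{k}. a i *\<^sub>R m i)"
  proof -
    have "(\<Sum>i\<in>-{k}. a i *\<^sub>R m i) = (- 1 / c k) *\<^sub>R (\<Sum>i\<in>-{k}. c i *\<^sub>R m i)"
      by (simp add: a_def scaleR_sum_right)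
    also have "(\<Sum>i\<in>-{k}. c i *\<^sub>R m i) = - (c k *\<^sub>R w)"
      using split by (simp add: eq_neg_iff_add_eq_0 add.commute)
    finally show ?thesis using \<open>c k \<noteq> 0\<close> by simp
  qed
  define s where "s = (\<Sum>i\<in>-{k}. \<bar>a i\<bar>)"
  have le1: "\<bar>m i \<bullet> u\<bar> \<le> 1" "\<bar>m i \<bullet> v\<bar> \<le> 1" for i
    using Cauchy_Schwarz_ineq2[of "m i"] unit uv by (metis mult_1)+
  have half: "\<bar>p - q\<bar> \<le> 1/2 \<and> (\<bar>p - q\<bar> = 1/2 \<longrightarrow> \<bar>p\<bar> = 1 \<or> \<bar>q\<bar> = 1)"
    if "p \<ge> 1/2 \<and> q \<ge> 1/2 \<or> p \<le> - (1/2) \<and> q \<le> - (1/2)" "\<bar>p\<bar> \<le> 1" "\<bar>q\<bar> \<le> 1" for p q :: real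
    using that by arith
  have mw: "\<bar>m i \<bullet> w\<bar> \<le> 1/2" if "i \<noteq> k" for i
    using half[OF cell[OF that] le1[of i]] unfolding w_def inner_diff_right by blast
  have summand: "a i * (m i \<bullet> w) \<le> \<bar>a i\<bar> / 2" if "i \<noteq> k" for i
  proof -
    have "a i * (m i \<bullet> w) \<le> \<bar>a i\<bar> * \<bar>m i \<bullet> w\<bar>"
      by (metis abs_ge_self abs_mult)
    also have "\<dots> \<le> \<bar>a i\<bar> * (1/2)" using mw[OF that] by (intro mult_left_mono) auto
    finally show ?thesis by simp
  qed
  have ww: "w \<bullet> w = (\<Sum>i\<in>-{k}. a i * (m i \<bullet> w))"
  proof -
    have "w \<bullet> w = (\<Sum>i\<in>-{k}. a i *\<^sub>R m i) \<bullet> w" using wa by simp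
    then show ?thesis by (simp add: inner_sum_left)
  qed
  have upper: "(norm w)\<^sup>2 \<le> s / 2"
  proof -
    have "w \<bullet> w \<le> (\<Sum>i\<in>-{k}. \<bar>a i\<bar> / 2)" unfolding ww using summand by (intro sum_mono) simp
    then show ?thesis by (simp add: s_def sum_divide_distrib power2_norm_eq_inner)
  qed
  have lower: "s / 2 \<le> w \<bullet> x" 
    if "s / 2 \<le> (\<Sum>i\<in>-{k}. a i *\<^sub>R m i) \<bullet> x" for x using that wa by simp
  have "s / 2 \<le> norm w"
  proof -
    obtain x where x: "norm x = 1" "s / 2 \<le> (\<Sum>i\<in>-{k}. a i *\<^sub>R m i) \<bullet> x"
      using supp[of a "{i. a i > 0}"] by (auto simp: s_def)
    have "w \<bullet> x \<le> norm w" using norm_cauchy_schwarz[of w x] x by simp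
    with lower[OF x(2)] show ?thesis by simp
  qed
  with upper have "(norm w)\<^sup>2 \<le> norm w" by simp
  then have "norm w * norm w \<le> norm w * 1" by (simp add: power2_eq_square)
  moreover have "norm w > 0" using w1 by linarith
  ultimately have "norm w \<le> 1" by (simp only: mult_le_cancel_left_pos)
  with w1 have nw: "norm w = 1" by simp
  then have s2: "s = 2" using upper \<open>s / 2 \<le> norm w\<close> by simp
  have tight: "\<bar>m i \<bullet> w\<bar> = 1/2" if i: "i \<noteq> k" "a i \<noteq> 0" for i
  proof -
    have "(\<Sum>i\<in>-{k}. \<bar>a i\<bar> / 2 - a i * (m i \<bullet> w)) = s / 2 - w \<bullet> w"
      by (simp add: sum_subtractf ww s_def sum_divide_distrib)
    also have "\<dots> = 0" using s2 nw by (simp add: dot_square_norm)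
    finally have "\<forall>i\<in>-{k}. \<bar>a i\<bar> / 2 - a i * (m i \<bullet> w) = 0"
      using summand by (subst (asm) sum_nonneg_eq_0_iff) auto
    then have "\<bar>a i\<bar> / 2 = a i * (m i \<bullet> w)" using i by simp
    then have "\<bar>a i\<bar> * \<bar>m i \<bullet> w\<bar> = \<bar>\<bar>a i\<bar> / 2\<bar>" by (simp only: abs_mult)
    with i show ?thesis by simp
  qed
  show False
  proof (cases "\<exists>i. i \<noteq> k \<and> a i = 0")
    case True
    then obtain j where j: "j \<noteq> k" "a j = 0" by blast
    (* the two patterns differ exactly at the zero coefficients, in particular at j *)
    obtain x where x: "norm x = 1" "m j \<bullet> x \<le> - (1/2)" "s / 2 \<le> (\<Sum>i\<in>-{k}. a i *\<^sub>R m i) \<bullet> x"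
      using supp[of a "{i. a i > 0}"] j by (auto simp: s_def)
    obtain y where y: "norm y = 1" "m j \<bullet> y \<ge> 1/2" "s / 2 \<le> (\<Sum>i\<in>-{k}. a i *\<^sub>R m i) \<bullet> y"
      using supp[of a "{i. a i \<ge> 0}"] j by (fastforce simp: s_def)
    have "w = x" "w = y"
      using lower[OF x(3)] lower[OF y(3)] s2 nw x(1) y(1) by (auto intro!: unit_vectors_eq_of_inner)
    with x(2) y(2) show False by simp
  next
    case False
    have pt: "\<bar>m i \<bullet> u\<bar> = 1 \<or> \<bar>m i \<bullet> v\<bar> = 1" if "i \<noteq> k" for i
    proof -
      have "\<bar>m i \<bullet> w\<bar> = 1/2" using tight False that by blast
      then show ?thesis
        using half[OF cell[OF that] le1[of i]] unfolding w_def inner_diff_right by blast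
    qed
    have sgn: "\<exists>t. \<bar>t\<bar> = 1 \<and> m i = t *\<^sub>R z" if "\<bar>m i \<bullet> z\<bar> = 1" "norm z = 1" for i z
    proof (cases "m i \<bullet> z \<ge> 0")
      case True
      then have "m i = z" using that unit by (intro unit_vectors_eq_of_inner) auto
      then show ?thesis by (intro exI[of _ 1]) simp
    next
      case False
      then have "m i = - z" using that unit by (intro unit_vectors_eq_of_inner) auto
      then show ?thesis by (intro exI[of _ "-1"]) simp
    qed
    have no: False if ij: "i \<noteq> k" "j \<noteq> k" "i \<noteq> j" "\<bar>m i \<bullet> z\<bar> = 1" "\<bar>m j \<bullet> z\<bar> = 1" "norm z = 1" for i j z
    proof -
      obtain t where t: "\<bar>t\<bar> = 1" "m i = t *\<^sub>R z" using sgn[OF ij(4,6)] by blast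
      obtain r where r: "\<bar>r\<bar> = 1" "m j = r *\<^sub>R z" using sgn[OF ij(5,6)] by blast
      note tr = t r
      have "m j = (r * t) *\<^sub>R m i" using tr by (auto simp: abs_if split: if_splits)
      moreover have "r * t = 1 \<or> r * t = - 1" using tr by (auto simp: abs_if split: if_splits)
      ultimately have "m j = m i \<or> m j = - m i" by auto
      then show False
      proof
        assume e: "m j = m i"
        obtain x where "\<And>p. p \<noteq> k \<Longrightarrow> if p \<in> {i} then m p \<bullet> x \<ge> 1/2 else m p \<bullet> x \<le> - (1/2)"
          using shattered[of "{i}"] by blast
        from this[OF ij(1)] this[OF ij(2)] show False using e ij(3) by simp
      next
        assume e: "m j = - m i"
        obtain x where "\<And>p. p \<noteq> k \<Longrightarrow> if p \<in> {i, j} then m p \<bullet> x \<ge> 1/2 else m p \<bullet> x \<le> - (1/2)"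
          using shattered[of "{i, j}"] by blast
        from this[OF ij(1)] this[OF ij(2)] show False using e by simp
      qed
    qed
    have "card (-{k}) = 3" by (simp add: Compl_eq_Diff_UNIV card_Diff_subset)
    then obtain i j l where "- {k} = {i, j, l}" "i \<noteq> j" "j \<noteq> l" "i \<noteq> l"
      by (auto simp: card_3_iff)
    moreover from this have "i \<noteq> k" "j \<noteq> k" "l \<noteq> k" by auto
    ultimately show False using pt[of i] pt[of j] pt[of l] no uv by blast
  qed
qed

section \<open>Four normals do not realize eight cells\<close>

text \<open>The set \<open>R\<close> of realized patterns is closed under complements, contains neither the empty nor the full
  set, and has at least eight members, so at least four of the seven classes (four singletons and three
  partitions into pairs) occur. If two singletons and their union occurred, no other class could: all
  other patterns contain exactly one of the two remaining indices, whereas the normals of these two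
  indices coincide. So two realized singletons exclude the class of their union. Counting
  then leaves these cases: all four singletons, against the weights; two singletons and both
  partitions that separate them; or one singleton and all three partitions. In the last two cases the
  three normals other than that of a realized singleton realize all sign patterns, and \<open>v\<close> shares a
  cell with a vector of \<open>Y\<close>.\<close>
lemma no_eight_cells_of_four_normals:
  fixes m :: "4 \<Rightarrow> real^3" and Y :: "(real^3) set"
  defines "R \<equiv> \<lambda>A. \<exists>x\<in>Y. realizes m x A"
  assumes unit: "\<And>i. norm (m i) = 1"
    and d: "\<And>i. d i \<ge> 0" "sum d UNIV = 1" "(\<Sum>i\<in>UNIV. d i *\<^sub>R m i) = 0"
    and sym: "\<And>x. x \<in> Y \<Longrightarrow> - x \<in> Y"
    and v: "norm v = 1" "\<And>i. \<bar>m i \<bullet> v\<bar> \<ge> 1/2" "\<And>x. x \<in> Y \<Longrightarrow> x \<bullet> v \<le> 1/2"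
    and many: "card {A. R A} \<ge> 8"
  shows False
proof -
  have R_compl: "R (- A) \<longleftrightarrow> R A" for A
    unfolding R_def using sym realizes_uminus[of m _ A] by (metis minus_minus)
  have pair: "\<not> R A"
    if "R {i}" "R {j}" "R {i, j}" "k \<in> A" "l \<notin> A" "distinct [i, j, k, l]" "UNIV = {i, j, k, l}"
    for i j k l A
  proof
    assume "R A"
    have "m k = m l"
      using that(1-3) normals_eq_of_three_cells[OF unit d that(6,7)] unfolding R_def by blast
    moreover obtain x where "realizes m x A" using \<open>R A\<close> unfolding R_def by blast
    ultimately show False
      using realizes_in[of m x A k] realizes_notin[of m x A l] that(4,5) by simp
  qed
  have shatter: False if full: "\<And>B. k \<notin> B \<Longrightarrow> R B \<or> R (insert k B)" for k
  proof -
    have sh: "\<exists>x\<in>Y. norm x = 1 \<and> (\<forall>i. i \<noteq> k \<longrightarrow>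
        (if i \<in> B then m i \<bullet> x \<ge> 1/2 else m i \<bullet> x \<le> - (1/2)))" for B
    proof -
      obtain x B' where "x \<in> Y" "realizes m x B'" "B' = B - {k} \<or> B' = insert k (B - {k})"
        using full[of "B - {k}"] unfolding R_def by blast
      then show ?thesis
        by (intro bexI[of _ x]) (auto simp: realizes_def split: if_splits)
    qed
    obtain x where x: "x \<in> Y" "norm x = 1" and cell:
      "\<And>i. i \<noteq> k \<Longrightarrow> if i \<in> {i. m i \<bullet> v > 0} then m i \<bullet> x \<ge> 1/2 else m i \<bullet> x \<le> - (1/2)"
      using sh[of "{i. m i \<bullet> v > 0}"] by blast
    have "norm (x - v) < 1"
    proof (rule shattered_cell_diameter[OF unit _ x(2) v(1)])
      show "\<exists>x. norm x = 1 \<and> (\<forall>i. i \<noteq> k \<longrightarrow>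
        (if i \<in> B then m i \<bullet> x \<ge> 1/2 else m i \<bullet> x \<le> - (1/2)))" for B using sh[of B] by blast
      show "m i \<bullet> x \<ge> 1/2 \<and> m i \<bullet> v \<ge> 1/2 \<or> m i \<bullet> x \<le> - (1/2) \<and> m i \<bullet> v \<le> - (1/2)"
        if "i \<noteq> k" for i
        using cell[OF that] v(2)[of i] by (auto simp: abs_if split: if_splits)
    qed
    moreover have "(norm (x - v))\<^sup>2 = 2 - 2 * (x \<bullet> v)"
    proof -
      have "x \<bullet> x = 1" "v \<bullet> v = 1" using x(2) v(1) by (simp_all add: dot_square_norm)
      then show ?thesis by (simp add: power2_norm_eq_inner inner_diff inner_commute[of v x])
    qed
    ultimately show False
      using v(3)[OF x(1)] abs_square_less_1[of "norm (x - v)"] by simp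
  qed
  have ineq: "sum d A \<ge> 1/3" if "R A" for A
    using that weight_ge[OF unit d] unfolding R_def by blast
  have "\<not> R {}" using ineq[of "{}"] by auto
  then have nU: "\<not> R UNIV" using R_compl[of "{}"] by simp

  have count: "4 \<le> of_bool (R {i}) + of_bool (R {j}) + of_bool (R {k}) + of_bool (R {l})
      + of_bool (R {i, j}) + of_bool (R {i, k}) + (of_bool (R {i, l}) :: nat)"
    if U: "distinct [i, j, k, l]" "UNIV = {i, j, k, l}" for i j k l
  proof -
    let ?L = "[{i}, {j}, {k}, {l}, {i, j}, {i, k}, {i, l}]"
    have all: "p = i \<or> p = j \<or> p = k \<or> p = l" for p using UNIV_I[of p] unfolding U(2) by simp
    have compl: "- {l} = {i, j, k}" "- {k} = {i, j, l}" "- {j} = {i, k, l}"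
      unfolding Compl_eq_Diff_UNIV U(2) using U(1) by auto
    define F where "F = set (filter R ?L)"
    have base: "A \<in> F \<or> - A \<in> F" if "R A" "i \<in> A" for A
    proof -
      have eq: "A = insert i ((if j \<in> A then {j} else {}) \<union> ((if k \<in> A then {k} else {}) \<union> (if l \<in> A then {l} else {})))"
        using \<open>i \<in> A\<close> all by (auto split: if_splits)
      have "C = {i} \<or> C = {i, j} \<or> C = {i, k} \<or> C = {i, l} \<or> C = {i, j, k} \<or> C = {i, j, l} \<or>
          C = {i, k, l} \<or> C = {i, j, k, l}"
        if "C = insert i ((if b1 then {j} else {}) \<union> ((if b2 then {k} else {}) \<union> (if b3 then {l} else {})))"
        for C b1 b2 b3
        unfolding that by (cases b1; cases b2; cases b3; simp only: if_True if_False Un_insert_left Un_empty_left simp_thms)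
      from this[OF eq] have "A \<in> {{i}, {i, j}, {i, k}, {i, l}, {i, j, k}, {i, j, l}, {i, k, l}}"
        using nU \<open>R A\<close> U(2) by (elim disjE) simp_all
      then have "A \<in> set ?L \<or> - A \<in> set ?L"
        unfolding compl[symmetric] by (elim insertE emptyE) simp_all
      moreover have "R (- A)" using R_compl \<open>R A\<close> by blast
      ultimately show ?thesis
        unfolding F_def set_filter mem_Collect_eq using \<open>R A\<close> by blast
    qed
    have "{A. R A} \<subseteq> F \<union> uminus ` F"
    proof
      fix A assume "A \<in> {A. R A}"
      then have "R A" "R (- A)" using R_compl by auto
      then have "A \<in> F \<or> - A \<in> F"
        using base[of A] base[of "- A"] by auto
      then show "A \<in> F \<union> uminus ` F" by (metis UnCI double_compl image_eqI)
    qed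
    moreover have "finite F" by (simp only: F_def finite_set)
    ultimately have "card {A. R A} \<le> card (F \<union> uminus ` F)"
      by (intro card_mono) simp_all
    also have "\<dots> \<le> card F + card (uminus ` F)" by (rule card_Un_le)
    also have "\<dots> \<le> card F + card F"
      using \<open>finite F\<close> by (intro add_left_mono card_image_le)
    also have "\<dots> \<le> length (filter R ?L) + length (filter R ?L)"
      unfolding F_def by (intro add_mono card_length)
    finally have "4 \<le> length (filter R ?L)" using many by linarith
    also have "length (filter R ?L) = of_bool (R {i}) + (of_bool (R {j}) + (of_bool (R {k}) +
      (of_bool (R {l}) + (of_bool (R {i, j}) + (of_bool (R {i, k}) + (of_bool (R {i, l}) + 0))))))"
    proof -
      have fl: "length (filter R (B # Bs)) = of_bool (R B) + length (filter R Bs)" for B Bs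
        by simp
      show ?thesis by (simp only: fl filter.simps(1) list.size)
    qed
    finally show ?thesis by linarith
  qed

  have four: "\<not> (R {i} \<and> R {j} \<and> R {k} \<and> R {l})"
    if U: "distinct [i, j, k, l]" "UNIV = {i, j, k, l}" for i j k l
  proof -
    have "d i + d j + d k + d l = 1" using d(2) U(1) unfolding U(2) by (simp add: add.assoc)
    then show ?thesis using ineq[of "{i}"] ineq[of "{j}"] ineq[of "{k}"] ineq[of "{l}"] by auto
  qed

  have spanned: "\<not> R {i, j}"
    if U: "distinct [i, j, k, l]" "UNIV = {i, j, k, l}" and r: "R {i}" "R {j}" for i j k l
  proof
    assume p: "R {i, j}"
    have kl: "\<not> R A" if "k \<in> A" "l \<notin> A" for A
      using pair[OF r p that] U by blast
    have lk: "\<not> R A" if "l \<in> A" "k \<notin> A" for A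
    proof (rule pair[OF r p that])
      show "distinct [i, j, l, k]" using U(1) by auto
      show "UNIV = {i, j, l, k}" using U(2) by (metis insert_commute)
    qed
    show False
      using kl[of "{k}"] lk[of "{l}"] kl[of "{i, k}"] lk[of "{i, l}"] count[OF U] U(1) r p by auto
  qed

  have shattered: False
    if U: "distinct [k, i, j, l]" "UNIV = {k, i, j, l}"
      and "R {k}" "R {i} \<or> R {k, i}" "R {j} \<or> R {k, j}" "R {l} \<or> R {k, l}" for k i j l
  proof (rule shatter[of k])
    fix B assume "k \<notin> B"
    have c: "- {k} = {i, j, l}" "- {i} = {k, j, l}" "- {j} = {k, i, l}" "- {l} = {k, i, j}"
      "- {k, i} = {j, l}" "- {k, j} = {i, l}" "- {k, l} = {i, j}"
      unfolding Compl_eq_Diff_UNIV U(2) using U(1) by auto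
    have rc: "R {i, j, l}" "R {k, j, l} \<or> R {j, l}" "R {k, i, l} \<or> R {i, l}" "R {k, i, j} \<or> R {i, j}"
      using that(3-6) R_compl[of "{k}"] R_compl[of "{i}"] R_compl[of "{j}"] R_compl[of "{l}"]
        R_compl[of "{k, i}"] R_compl[of "{k, j}"] R_compl[of "{k, l}"] unfolding c by auto
    have "p = k \<or> p = i \<or> p = j \<or> p = l" for p using UNIV_I[of p] unfolding U(2) by simp
    with \<open>k \<notin> B\<close> have "\<forall>p\<in>B. p = i \<or> p = j \<or> p = l" by metis
    then have B: "B = (if i \<in> B then {i} else {}) \<union> (if j \<in> B then {j} else {}) \<union> (if l \<in> B then {l} else {})"
      using U(1) \<open>k \<notin> B\<close> by auto
    have "R C \<or> R (insert k C)"
      if "C = (if b1 then {i} else {}) \<union> (if b2 then {j} else {}) \<union> (if b3 then {l} else {})" for C b1 b2 b3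
      using \<open>R {k}\<close> \<open>R {i} \<or> R {k, i}\<close> \<open>R {j} \<or> R {k, j}\<close> \<open>R {l} \<or> R {k, l}\<close> rc that
      by (cases b1; cases b2; cases b3) (simp_all add: insert_commute disj_commute)
    from this[OF B] show "R B \<or> R (insert k B)" .
  qed

  have at_most_one: "\<not> R {j}"
    if U: "distinct [i, j, k, l]" "UNIV = {i, j, k, l}" and "R {i}" for i j k l
  proof
    assume "R {j}"
    have Us: "UNIV = {i, j, k, l}" "UNIV = {i, k, j, l}" "UNIV = {j, k, i, l}" "UNIV = {i, l, j, k}" "UNIV = {j, l, i, k}"
      using U(2) by (simp_all add: insert_commute)
    have compl: "- {i, l} = {j, k}" "- {i, k} = {j, l}"
      unfolding Compl_eq_Diff_UNIV U(2) using U(1) by auto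
    have ij: "\<not> R {i, j}" using spanned[OF U] \<open>R {i}\<close> \<open>R {j}\<close> by blast
    have k: "\<not> R {i, k} \<and> \<not> R {i, l}" if "R {k}"
      using spanned[OF _ Us(2)] spanned[OF _ Us(3)] U(1) \<open>R {i}\<close> \<open>R {j}\<close> that
        R_compl[of "{i, l}"] unfolding compl by auto
    have l: "\<not> R {i, k} \<and> \<not> R {i, l}" if "R {l}"
      using spanned[OF _ Us(4)] spanned[OF _ Us(5)] U(1) \<open>R {i}\<close> \<open>R {j}\<close> that
        R_compl[of "{i, k}"] unfolding compl by auto
    have "\<not> R {k}" using count[OF U] four[OF U] ij k \<open>R {i}\<close> \<open>R {j}\<close> by (cases "R {l}") auto
    moreover have "\<not> R {l}" using count[OF U] four[OF U] ij l \<open>R {i}\<close> \<open>R {j}\<close> by (cases "R {k}") auto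
    ultimately have "R {i, k}" "R {i, l}"
      using count[OF U] ij by (auto simp: of_bool_def split: if_splits)
    then show False using shattered[OF U] \<open>R {i}\<close> \<open>R {j}\<close> by blast
  qed

  have univ: "distinct [1, 2, 3, 4::4]" "UNIV = {1, 2, 3, 4::4}" using UNIV_4 by auto
  have "\<exists>i. R {i}"
  proof (rule ccontr)
    assume "\<nexists>i. R {i}"
    then show False using count[OF univ] by (auto simp: of_bool_def split: if_splits)
  qed
  then obtain i where "R {i}" by blast
  have "card (- {i}) = 3" by (simp add: Compl_eq_Diff_UNIV card_Diff_subset)
  then obtain j k l where jkl: "- {i} = {j, k, l}" "j \<noteq> k" "k \<noteq> l" "j \<noteq> l"
    by (auto simp: card_3_iff)
  then have "i \<notin> {j, k, l}" by blast
  then have D: "distinct [i, j, k, l]" "distinct [i, k, j, l]" "distinct [i, l, j, k]" using jkl by auto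
  have "UNIV = insert i (- {i})" by auto
  then have U: "UNIV = {i, j, k, l}" "UNIV = {i, k, j, l}" "UNIV = {i, l, j, k}"
    unfolding jkl(1) by (simp_all add: insert_commute)
  have none: "\<not> R {j}" "\<not> R {k}" "\<not> R {l}"
    using at_most_one[OF D(1) U(1)] at_most_one[OF D(2) U(2)] at_most_one[OF D(3) U(3)] \<open>R {i}\<close> by auto
  then have "R {i, j}" "R {i, k}" "R {i, l}"
    using count[OF D(1) U(1)] by (auto simp: of_bool_def split: if_splits)
  then show False using shattered[OF D(1) U(1)] \<open>R {i}\<close> by blast
qed

section \<open>At most eight directions\<close>

text \<open>This reduces the geometric situation to the weighted one. Each \<open>n\<^sub>i\<close> is given the sign of its
  coefficient in a linear dependency, which makes all weights nonnegative. Since \<open>n\<^sub>1\<close> has the same sign at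
  every \<open>x\<^sub>j\<close>, the patterns of the \<open>x\<^sub>j\<close> are not complementary to each other, so together with their
  complements they are eight.\<close>
lemma no_fifth_direction_beside_four:
  fixes x :: "4 \<Rightarrow> real^3" and n :: "4 \<Rightarrow> real^3"
  assumes x: "\<And>j. norm (x j) = 1" and v: "norm v = 1" and n: "\<And>i. norm (n i) = 1"
    and clear: "\<And>i j. \<bar>n i \<bullet> x j\<bar> \<ge> 1/2" "\<And>i. \<bar>n i \<bullet> v\<bar> \<ge> 1/2"
    and side: "\<And>j. n 1 \<bullet> x j > 0"
    and sep: "\<And>j k. j \<noteq> k \<Longrightarrow> \<exists>i. (n i \<bullet> x j > 0) \<noteq> (n i \<bullet> x k > 0)"
    and xv: "\<And>j. \<bar>x j \<bullet> v\<bar> \<le> 1/2"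
  shows False
proof -
  obtain c where c: "c \<noteq> (\<lambda>_. 0)" "(\<Sum>i\<in>UNIV. c i *\<^sub>R n i) = 0"
    using exists_linear_dependency by blast
  define e where "e i = (if c i \<ge> 0 then 1 else - 1 :: real)" for i
  define m where "m i = e i *\<^sub>R n i" for i
  define s where "s = (\<Sum>i\<in>UNIV. \<bar>c i\<bar>)"
  define d where "d i = \<bar>c i\<bar> / s" for i
  have ee: "e i * e i = 1" "\<bar>e i\<bar> = 1" for i by (simp_all add: e_def)
  have "s \<noteq> 0"
  proof
    assume "s = 0"
    then have "\<forall>i\<in>UNIV. \<bar>c i\<bar> = 0" unfolding s_def by (subst (asm) sum_nonneg_eq_0_iff) auto
    with c(1) show False by (auto simp: fun_eq_iff)
  qed
  moreover have "s \<ge> 0" unfolding s_def by (simp add: sum_nonneg)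
  ultimately have "s > 0" by simp
  have m: "norm (m i) = 1" for i using n ee by (simp add: m_def)
  have d: "d i \<ge> 0" "sum d UNIV = 1" "(\<Sum>i\<in>UNIV. d i *\<^sub>R m i) = 0" for i
  proof -
    show "d i \<ge> 0" using \<open>s > 0\<close> by (simp add: d_def)
    show "sum d UNIV = 1" using \<open>s > 0\<close> by (simp add: d_def s_def flip: sum_divide_distrib)
    have "d i *\<^sub>R m i = (1 / s) *\<^sub>R (c i *\<^sub>R n i)" for i by (simp add: d_def m_def e_def)
    then have "(\<Sum>i\<in>UNIV. d i *\<^sub>R m i) = (1 / s) *\<^sub>R (\<Sum>i\<in>UNIV. c i *\<^sub>R n i)"
      by (simp only: scaleR_sum_right)
    then show "(\<Sum>i\<in>UNIV. d i *\<^sub>R m i) = 0" using c(2) by simp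
  qed
  define Y where "Y = range x \<union> uminus ` range x"
  define pat where "pat y = {i. m i \<bullet> y > 0}" for y
  have mx: "\<bar>m i \<bullet> x j\<bar> \<ge> 1/2" for i j
    using clear(1)[of i j] ee(2)[of i] by (simp add: m_def abs_mult)
  have R: "realizes m (x j) (pat (x j))" for j
    unfolding realizes_def
  proof (intro conjI allI)
    show "if i \<in> pat (x j) then m i \<bullet> x j \<ge> 1/2 else m i \<bullet> x j \<le> - (1/2)" for i
      using mx[of i j] by (auto simp: pat_def)
  qed (rule x)
  have inj: "inj (\<lambda>j. pat (x j))"
  proof (rule injI, rule ccontr)
    fix j k assume "pat (x j) = pat (x k)" "j \<noteq> k"
    obtain i where i: "(n i \<bullet> x j > 0) \<noteq> (n i \<bullet> x k > 0)" using sep[OF \<open>j \<noteq> k\<close>] by blast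
    have "i \<in> pat (x j) \<longleftrightarrow> i \<in> pat (x k)" using \<open>pat (x j) = pat (x k)\<close> by simp
    then have "m i \<bullet> x j > 0 \<longleftrightarrow> m i \<bullet> x k > 0" by (simp add: pat_def)
    then show False using i clear(1)[of i j] clear(1)[of i k]
      by (auto simp: m_def e_def split: if_splits)
  qed
  have first: "(1 \<in> pat (x j)) = (e 1 = 1)" for j
    using side[of j] by (auto simp: pat_def m_def e_def)
  define F where "F = range (\<lambda>j. pat (x j))"
  have cF: "card F = 4" unfolding F_def using card_image[OF inj] by simp
  have cF': "card (uminus ` F) = 4"
    using cF card_image[of uminus F] by (simp add: inj_on_def)
  have "1 \<in> A \<longleftrightarrow> e 1 = 1" if "A \<in> F" for A using first that by (auto simp: F_def)
  then have "- A \<notin> F" if "A \<in> F" for A using that by (metis ComplD ComplI)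
  then have "F \<inter> uminus ` F = {}" by auto
  then have c8: "card (F \<union> uminus ` F) = 8"
    using cF cF' by (subst card_Un_disjoint) (auto simp: F_def)
  have sub: "F \<union> uminus ` F \<subseteq> {A. \<exists>y\<in>Y. realizes m y A}"
  proof
    fix A assume "A \<in> F \<union> uminus ` F"
    then obtain j where "A = pat (x j) \<or> A = - pat (x j)" by (auto simp: F_def)
    then have "realizes m (x j) A \<or> realizes m (- x j) A"
      using R[of j] realizes_uminus[of m "x j" "pat (x j)"] by auto
    then show "A \<in> {A. \<exists>y\<in>Y. realizes m y A}" by (auto simp: Y_def)
  qed
  have many: "card {A. \<exists>y\<in>Y. realizes m y A} \<ge> 8"
    using card_mono[OF finite sub] unfolding c8 .
  show False
  proof (rule no_eight_cells_of_four_normals[OF m d _ v _ _ many])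
    show "- y \<in> Y" if "y \<in> Y" for y using that by (auto simp: Y_def)
    show "\<bar>m i \<bullet> v\<bar> \<ge> 1/2" for i using clear(2)[of i] ee(2)[of i] by (simp add: m_def abs_mult)
    show "y \<bullet> v \<le> 1/2" if y: "y \<in> Y" for y
    proof -
      obtain j where "y = x j \<or> y = - x j" using y unfolding Y_def by blast
      then show ?thesis using xv[of j] by auto
    qed
  qed
qed

text \<open>Separated points are at distance at least \<open>1\<close>, because the plane leaves a gap of width \<open>1\<close> in the
  direction of its normal.\<close>
lemma separated_inner_le:
  assumes "norm n = 1" "n \<bullet> u \<ge> 1/2" "n \<bullet> v \<le> - (1/2)" "norm u = 1" "norm v = 1"
  shows "u \<bullet> v \<le> 1/2"
proof -
  have uv: "u \<bullet> u = 1" "v \<bullet> v = 1" using assms by (simp_all add: dot_square_norm)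
  have "n \<bullet> (u - v) \<le> norm (u - v)" using norm_cauchy_schwarz[of n "u - v"] assms by simp
  then have "norm (u - v) \<ge> 1" using assms by (simp add: inner_diff_right)
  then have "(norm (u - v))\<^sup>2 \<ge> 1" by (simp add: one_le_power)
  then show ?thesis using uv by (simp add: power2_norm_eq_inner inner_diff inner_commute[of v u])
qed

text \<open>A third point agrees with at most one of two points that are already separated, and a fourth point
  with at most one of three. So one further test per point is enough.\<close>
lemma three_tests_separate_four:
  fixes s :: "'n \<Rightarrow> 'x \<Rightarrow> bool"
  assumes sep: "\<And>u w. u \<in> {a, b, c, e} \<Longrightarrow> w \<in> {a, b, c, e} \<Longrightarrow> u \<noteq> w \<Longrightarrow> \<exists>n\<in>N. s n u \<noteq> s n w"
    and dist: "distinct [a, b, c, e]"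
  obtains n1 n2 n3 where "n1 \<in> N" "n2 \<in> N" "n3 \<in> N"
    "\<forall>u\<in>{a, b, c, e}. \<forall>w\<in>{a, b, c, e}. u \<noteq> w \<longrightarrow>
      s n1 u \<noteq> s n1 w \<or> s n2 u \<noteq> s n2 w \<or> s n3 u \<noteq> s n3 w"
proof -
  obtain n1 where n1: "n1 \<in> N" "s n1 a \<noteq> s n1 b" using sep[of a b] dist by auto
  define p where "p = (if s n1 c = s n1 a then a else b)"
  have "p \<in> {a, b, c, e}" "p \<noteq> c" using dist by (auto simp: p_def)
  then obtain n2 where n2: "n2 \<in> N" "s n2 c \<noteq> s n2 p" using sep[of c p] by auto
  (* c is tried first: if e agrees with c on n1 and n2, it differs from a and b there *)
  define q where "q = (if s n1 e = s n1 c \<and> s n2 e = s n2 c then c else if s n1 e = s n1 a then a else b)"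
  have "q \<in> {a, b, c, e}" "q \<noteq> e" using dist by (auto simp: q_def)
  then obtain n3 where n3: "n3 \<in> N" "s n3 e \<noteq> s n3 q" using sep[of e q] by auto
  have ab: "s n1 a \<noteq> s n1 b" by (rule n1(2))
  have ac: "s n1 a \<noteq> s n1 c \<or> s n2 a \<noteq> s n2 c" using n2(2) by (auto simp: p_def split: if_splits)
  have bc: "s n1 b \<noteq> s n1 c \<or> s n2 b \<noteq> s n2 c" using n1(2) n2(2) by (auto simp: p_def split: if_splits)
  have ae: "s n1 a \<noteq> s n1 e \<or> s n2 a \<noteq> s n2 e \<or> s n3 a \<noteq> s n3 e"
    using n3(2) ac by (cases "s n1 e = s n1 c \<and> s n2 e = s n2 c") (auto simp: q_def split: if_splits)
  have be: "s n1 b \<noteq> s n1 e \<or> s n2 b \<noteq> s n2 e \<or> s n3 b \<noteq> s n3 e"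
    using n3(2) bc ab by (cases "s n1 e = s n1 c \<and> s n2 e = s n2 c") (auto simp: q_def split: if_splits)
  have ce: "s n1 c \<noteq> s n1 e \<or> s n2 c \<noteq> s n2 e \<or> s n3 c \<noteq> s n3 e"
    using n3(2) by (auto simp: q_def split: if_splits)
  show ?thesis
    by (rule that[OF n1(1) n2(1) n3(1)]) (use ab ac bc ae be ce in auto)
qed

text \<open>Separation bounds the inner products of the five directions from above. The common normal \<open>n0\<close> also
  bounds them from below, since it separates each direction from the antipode of any other one.\<close>
lemma no_five_directions_on_one_side:
  assumes U: "separable_directions U" and n0: "norm n0 = 1" "\<And>w. w \<in> U \<Longrightarrow> \<bar>n0 \<bullet> w\<bar> \<ge> 1/2"
    and X: "X \<subseteq> U" "\<And>w. w \<in> X \<Longrightarrow> n0 \<bullet> w > 0" and card: "card X \<ge> 5"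
  shows False
proof -
  obtain X' where X': "X' \<subseteq> X" "card X' = 5" using card by (meson obtain_subset_with_card_n)
  then have "finite X'" by (simp add: card_ge_0_finite)
  then obtain xs where xs: "set xs = X'" "distinct xs" using finite_distinct_list by blast
  then have "length xs = 5" using X'(2) distinct_card by fastforce
  then obtain v a b c e where "xs = [v, a, b, c, e]"
    by (auto simp: numeral_eq_Suc length_Suc_conv)
  with xs X'(1) have dist: "distinct [a, b, c, e]" "v \<notin> {a, b, c, e}" and mem: "{v, a, b, c, e} \<subseteq> X" by auto
  have unit: "norm w = 1" if "w \<in> X" for w using that U X(1) by (auto simp: separable_directions_def)
  define N where "N = {n \<in> S2. \<forall>w\<in>U. \<bar>n \<bullet> w\<bar> \<ge> 1/2}"
  have sepN: "\<exists>n\<in>N. n \<bullet> u \<ge> 1/2 \<and> n \<bullet> w \<le> - (1/2)" if "u \<in> X" "w \<in> X" "u \<noteq> w" for u w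
  proof -
    have "u \<in> U" "w \<in> U" using that X(1) by auto
    then obtain n where "n \<in> S2" "n \<bullet> u \<ge> 1/2" "n \<bullet> w \<le> - (1/2)" "\<forall>p\<in>U. \<bar>n \<bullet> p\<bar> \<ge> 1/2"
      using U \<open>u \<noteq> w\<close> unfolding separable_directions_def by meson
    then show ?thesis by (intro bexI[of _ n]) (simp_all add: N_def)
  qed
  have sepb: "\<exists>n\<in>N. (n \<bullet> u > 0) \<noteq> (n \<bullet> w > 0)" if "u \<in> {a, b, c, e}" "w \<in> {a, b, c, e}" "u \<noteq> w" for u w
  proof -
    have "u \<in> X" "w \<in> X" using that mem by auto
    then obtain n where "n \<in> N" "n \<bullet> u \<ge> 1/2" "n \<bullet> w \<le> - (1/2)"
      using sepN[OF _ _ \<open>u \<noteq> w\<close>] by blast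
    then show ?thesis by (intro bexI[of _ n]) auto
  qed
  obtain n1 n2 n3 where n123: "n1 \<in> N" "n2 \<in> N" "n3 \<in> N" and
    sep: "\<forall>u\<in>{a, b, c, e}. \<forall>w\<in>{a, b, c, e}. u \<noteq> w \<longrightarrow>
      (n1 \<bullet> u > 0) \<noteq> (n1 \<bullet> w > 0) \<or> (n2 \<bullet> u > 0) \<noteq> (n2 \<bullet> w > 0) \<or> (n3 \<bullet> u > 0) \<noteq> (n3 \<bullet> w > 0)"
    by (rule three_tests_separate_four[of a b c e N "\<lambda>n u. n \<bullet> u > 0", OF sepb dist(1)]; (assumption | (rule that; assumption)))
  define n :: "4 \<Rightarrow> real^3" where "n i = (if i = 1 then n0 else if i = 2 then n1 else if i = 3 then n2 else n3)" for i
  define x :: "4 \<Rightarrow> real^3" where "x j = (if j = 1 then a else if j = 2 then b else if j = 3 then c else e)" for j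
  have n_vals: "n 1 = n0" "n 2 = n1" "n 3 = n2" "n 4 = n3" by (simp_all add: n_def)
  have xX: "x j \<in> X" "x j \<in> {a, b, c, e}" for j using mem by (auto simp: x_def)
  have "n0 \<in> N" using n0 by (simp add: N_def)
  then have nN: "n i \<in> N" for i using n123 by (simp add: n_def)
  have xj: "x j \<noteq> x k" if "j \<noteq> k" for j k
    using that dist(1) exhaust_4[of j] exhaust_4[of k] by (auto simp: x_def)
  have vX: "v \<in> X" using mem by simp
  show False
  proof (rule no_fifth_direction_beside_four[of x v n])
    show "norm (x j) = 1" for j using unit xX by blast
    show "norm v = 1" using unit vX by blast
    show "norm (n i) = 1" for i using nN[of i] by (simp add: N_def)
    show "\<bar>n i \<bullet> x j\<bar> \<ge> 1/2" for i j using nN[of i] xX(1)[of j] X(1) by (auto simp: N_def)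
    show "\<bar>n i \<bullet> v\<bar> \<ge> 1/2" for i using nN[of i] vX X(1) by (auto simp: N_def)
    show "n 1 \<bullet> x j > 0" for j using X(2)[OF xX(1)] n_vals by simp
    show "\<exists>i. (n i \<bullet> x j > 0) \<noteq> (n i \<bullet> x k > 0)" if "j \<noteq> k" for j k
    proof -
      have "x j \<in> {a, b, c, e}" "x k \<in> {a, b, c, e}" using xX(2) by blast+
      then have "(n 2 \<bullet> x j > 0) \<noteq> (n 2 \<bullet> x k > 0) \<or> (n 3 \<bullet> x j > 0) \<noteq> (n 3 \<bullet> x k > 0) \<or>
          (n 4 \<bullet> x j > 0) \<noteq> (n 4 \<bullet> x k > 0)"
        unfolding n_vals using sep xj[OF that] by (metis (no_types, lifting))
      then show ?thesis by blast
    qed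
    show "\<bar>x j \<bullet> v\<bar> \<le> 1/2" for j
    proof -
      have "x j \<noteq> v" using xX(2)[of j] dist(2) by metis
      then obtain n' where n': "norm n' = 1" "n' \<bullet> x j \<ge> 1/2" "n' \<bullet> v \<le> - (1/2)"
        using sepN[OF xX(1) vX] by (auto simp: N_def)
      have "x j \<bullet> v \<le> 1/2" using n' unit[OF xX(1)] unit[OF vX] by (intro separated_inner_le)
      moreover have "x j \<bullet> - v \<le> 1/2"
      proof (rule separated_inner_le[OF n0(1)])
        have "x j \<in> U" "v \<in> U" using xX(1) vX X(1) by auto
        then show "n0 \<bullet> x j \<ge> 1/2" "n0 \<bullet> - v \<le> - (1/2)"
          using n0(2)[of "x j"] n0(2)[of v] X(2)[OF xX(1), of j] X(2)[OF vX] by auto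
      qed (use unit xX(1) vX in auto)
      ultimately show ?thesis by auto
    qed
  qed
qed

lemma separable_directions_le_8:
  assumes U: "separable_directions U"
  shows "finite U \<and> card U \<le> 8"
proof (rule ccontr)
  assume "\<not> (finite U \<and> card U \<le> 8)"
  then have "\<exists>W\<subseteq>U. card W = 9 \<and> finite W"
  proof (cases "finite U")
    case True
    then have "9 \<le> card U" using \<open>\<not> (finite U \<and> card U \<le> 8)\<close> by simp
    then show ?thesis by (meson obtain_subset_with_card_n)
  next
    case False
    then show ?thesis using infinite_arbitrarily_large[of U 9] by blast
  qed
  then obtain W where W: "W \<subseteq> U" "card W = 9" "finite W" by blast
  have "\<not> (\<forall>p\<in>W. \<forall>q\<in>W. p = q)"
    using W(2) card_le_Suc0_iff_eq[OF W(3)] by simp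
  then obtain p q where "p \<in> W" "q \<in> W" "p \<noteq> q" by blast
  then obtain n where n: "norm n = 1" "\<And>w. w \<in> U \<Longrightarrow> \<bar>n \<bullet> w\<bar> \<ge> 1/2"
    using U W(1) unfolding separable_directions_def by (metis mem_sphere_0 subset_iff)
  let ?P = "{w \<in> W. n \<bullet> w > 0}" and ?M = "{w \<in> W. - n \<bullet> w > 0}"
  have "W = ?P \<union> ?M" using n(2) W(1) by force
  then have "9 \<le> card ?P + card ?M" using W(2) card_Un_le[of ?P ?M] by simp
  then consider "card ?P \<ge> 5" | "card ?M \<ge> 5" by linarith
  then show False
  proof cases
    case 1
    show False by (rule no_five_directions_on_one_side[OF U n _ _ 1]) (use W(1) in auto)
  next
    case 2
    show False by (rule no_five_directions_on_one_side[OF U, of "- n" ?M]) (use n W(1) 2 in auto)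
  qed
qed

section \<open>Balls, caps and central projection\<close>

text \<open>If \<open>z\<close> is a unit vector orthogonal to \<open>x\<close>, then the two points \<open>cos r x \<plusminus> sin r z\<close> of the cap around \<open>x\<close>
  have the sum \<open>2 cos r x\<close>. As both lie in the cap around \<open>y\<close>, this forces \<open>x \<bullet> y \<ge> 1\<close>.\<close>
lemma cap_center_unique:
  assumes "x \<in> S2" "y \<in> S2" "cap x r = cap y r" "cos r > 0"
  shows "x = y"
proof -
  have xx: "x \<bullet> x = 1" "y \<bullet> y = 1" using assms by (auto simp: dot_square_norm)
  obtain z0 where "z0 \<noteq> 0" "orthogonal x z0" using orthogonal_to_vector_exists[of x] by auto
  define z where "z = sgn z0"
  have z: "z \<bullet> z = 1" "x \<bullet> z = 0"
    using \<open>z0 \<noteq> 0\<close> \<open>orthogonal x z0\<close> by (auto simp: z_def dot_square_norm norm_sgn sgn_div_norm orthogonal_def)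
  have mem: "cos r *\<^sub>R x + t *\<^sub>R z \<in> cap x r" if "t\<^sup>2 = (sin r)\<^sup>2" for t
  proof -
    have "(norm (cos r *\<^sub>R x + t *\<^sub>R z))\<^sup>2 = (cos r)\<^sup>2 + t\<^sup>2"
      unfolding power2_norm_eq_inner using xx z
      by (simp add: inner_add inner_commute[of z x] power2_eq_square)
    then have "norm (cos r *\<^sub>R x + t *\<^sub>R z) = 1"
      using that by (simp add: power2_eq_1_iff) (smt (verit) norm_ge_zero)
    then show ?thesis using xx z by (simp add: cap_def inner_add_left inner_commute[of z x])
  qed
  have "cos r *\<^sub>R x + sin r *\<^sub>R z \<in> cap y r" "cos r *\<^sub>R x + (- sin r) *\<^sub>R z \<in> cap y r"
    using mem[of "sin r"] mem[of "- sin r"] assms(3) by auto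
  then have "2 * cos r * (x \<bullet> y) \<ge> 2 * cos r * 1" by (simp add: cap_def inner_diff_left inner_add_left)
  then have "x \<bullet> y \<ge> 1" using assms(4) by (simp only: mult_le_cancel_left_pos)
  then have "(x - y) \<bullet> (x - y) \<le> 0" using xx by (simp add: inner_diff inner_commute[of y x])
  then show ?thesis using inner_ge_zero[of "x - y"] by (metis eq_iff_diff_eq_0 inner_eq_zero_iff order_antisym)
qed

text \<open>A point \<open>p\<close> of the ball satisfies \<open>4(p \<bullet> u) \<ge> 3 + \<bar>p\<bar>\<^sup>2 \<ge> 2 sqrt 3 \<bar>p\<bar>\<close>. Equality holds at distance
  \<open>sqrt 3\<close> from the origin, where the tangent rays touch the ball, so a point \<open>y\<close> of the cap is the
  projection of \<open>sqrt 3 y\<close>.\<close>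
lemma central_projection_ball:
  assumes "norm u = 1"
  shows "central_projection (cball (2 *\<^sub>R u) 1) = cap u (pi/6)"
proof safe
  have uu: "u \<bullet> u = 1" using assms by (simp add: dot_square_norm)
  fix y assume "y \<in> central_projection (cball (2 *\<^sub>R u) 1)"
  then obtain x where x: "norm (2 *\<^sub>R u - x) \<le> 1" "y = sgn x"
    by (auto simp: central_projection_def dist_norm)
  have "x \<noteq> 0" using x assms by auto
  have "(norm (2 *\<^sub>R u - x))\<^sup>2 \<le> 1" using x(1) by (simp add: power_le_one)
  then have "4 * (x \<bullet> u) \<ge> 3 + (norm x)\<^sup>2"
    using uu by (simp add: power2_norm_eq_inner inner_diff inner_commute[of u x])
  moreover have "(norm x - sqrt 3)\<^sup>2 = (norm x)\<^sup>2 - 2 * (sqrt 3 * norm x) + 3"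
    by (simp add: power2_diff)
  moreover have "(norm x - sqrt 3)\<^sup>2 \<ge> 0" by simp
  ultimately have "2 * (x \<bullet> u) \<ge> sqrt 3 * norm x" by linarith
  then show "y \<in> cap u (pi/6)"
    using \<open>x \<noteq> 0\<close> by (simp add: x(2) cap_def norm_sgn sgn_div_norm cos_30 field_simps)
next
  have uu: "u \<bullet> u = 1" using assms by (simp add: dot_square_norm)
  fix y assume y: "y \<in> cap u (pi/6)"
  then have ny: "norm y = 1" and yu: "y \<bullet> u \<ge> sqrt 3 / 2" by (auto simp: cap_def cos_30)
  have yy: "y \<bullet> y = 1" using ny by (simp add: dot_square_norm)
  have "(norm (2 *\<^sub>R u - sqrt 3 *\<^sub>R y))\<^sup>2 = 7 - 4 * sqrt 3 * (y \<bullet> u)"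
    using uu yy
    by (simp add: power2_norm_eq_inner inner_diff inner_commute[of u y] right_diff_distrib)
  also have "\<dots> \<le> 7 - 4 * sqrt 3 * (sqrt 3 / 2)"
    using yu by (intro diff_left_mono mult_left_mono) auto
  finally have "(norm (2 *\<^sub>R u - sqrt 3 *\<^sub>R y))\<^sup>2 \<le> 1" by simp
  then have "sqrt 3 *\<^sub>R y \<in> cball (2 *\<^sub>R u) 1"
    by (simp add: dist_norm abs_square_le_1)
  moreover have "sgn (sqrt 3 *\<^sub>R y) = y" using ny by (simp add: sgn_div_norm)
  ultimately show "y \<in> central_projection (cball (2 *\<^sub>R u) 1)"
    unfolding central_projection_def by (metis image_eqI)
qed

section \<open>The cube and the octahedron\<close>

definition cube_coord :: real where
  "cube_coord = 1 / sqrt 3"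

lemma cube_coord: "cube_coord > 1/2" "cube_coord * cube_coord = 1/3"
proof -
  have "sqrt 3 < 2" by (simp add: real_less_lsqrt)
  then show "cube_coord > 1/2" by (simp add: cube_coord_def field_simps)
  show "cube_coord * cube_coord = 1/3" by (simp add: cube_coord_def)
qed

definition cube_directions :: "(real^3) set" where
  "cube_directions = {u. \<forall>i. \<bar>u $ i\<bar> = cube_coord}"

lemma cube_directions_coord:
  assumes "u \<in> cube_directions"
  shows "u $ i = cube_coord \<or> u $ i = - cube_coord" "u $ i * u $ i = 1/3"
proof -
  have "\<bar>u $ i\<bar> = cube_coord" using assms by (simp add: cube_directions_def)
  then show *: "u $ i = cube_coord \<or> u $ i = - cube_coord" by linarith
  then show "u $ i * u $ i = 1/3" using cube_coord(2) by auto
qed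

lemma cube_directions_unit: "cube_directions \<subseteq> S2"
proof
  fix u assume "u \<in> cube_directions"
  from cube_directions_coord(2)[OF this] have "u \<bullet> u = 1/3 + 1/3 + 1/3"
    by (simp only: inner_vec_def sum_3 inner_real_def)
  then have "u \<bullet> u = 1" by simp
  then show "u \<in> S2" by (simp add: norm_eq_1)
qed

lemma axis_inner: "axis i 1 \<bullet> u = u $ i" for u :: "real^3"
  by (simp add: inner_axis')

lemma cube_directions_separated:
  assumes "u \<in> cube_directions" "v \<in> cube_directions" "u \<noteq> v"
  obtains n where "n \<in> S2" "n \<bullet> u > 1/2" "- n \<bullet> v > 1/2"
    "\<And>w. w \<in> cube_directions \<Longrightarrow> n \<bullet> w > 1/2 \<or> - n \<bullet> w > 1/2"
proof -
  obtain i where i: "u $ i \<noteq> v $ i" using assms(3) by (auto simp: vec_eq_iff)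
  define n :: "real^3" where "n = (if u $ i > 0 then axis i 1 else - axis i 1)"
  have "n \<in> S2" by (simp add: n_def)
  moreover have "n \<bullet> u > 1/2" "- n \<bullet> v > 1/2"
    using i cube_directions_coord(1)[OF assms(1), of i] cube_directions_coord(1)[OF assms(2), of i]
      cube_coord(1) by (auto simp: n_def axis_inner)
  moreover have "n \<bullet> w > 1/2 \<or> - n \<bullet> w > 1/2" if "w \<in> cube_directions" for w
    using cube_directions_coord(1)[OF that, of i] cube_coord(1) by (auto simp: n_def axis_inner)
  ultimately show ?thesis by (rule that)
qed

lemma separable_cube_directions: "separable_directions cube_directions"
  unfolding separable_directions_def
proof (intro conjI ballI impI cube_directions_unit)
  fix u v assume uv: "u \<in> cube_directions" "v \<in> cube_directions" "u \<noteq> v"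
  obtain n where n: "n \<in> S2" "n \<bullet> u > 1/2" "- n \<bullet> v > 1/2"
    "\<And>w. w \<in> cube_directions \<Longrightarrow> n \<bullet> w > 1/2 \<or> - n \<bullet> w > 1/2"
    using cube_directions_separated[OF uv] by metis
  have "\<bar>n \<bullet> w\<bar> \<ge> 1/2" if "w \<in> cube_directions" for w
    using n(4)[OF that] by auto
  then show "\<exists>n\<in>S2. n \<bullet> u \<ge> 1/2 \<and> n \<bullet> v \<le> - (1/2) \<and> (\<forall>w\<in>cube_directions. \<bar>n \<bullet> w\<bar> \<ge> 1/2)"
    using n(1-3) by (intro bexI[of _ n]) auto
qed

lemma card_cube_directions: "finite cube_directions" "card cube_directions = 8"
proof -
  define f :: "3 set \<Rightarrow> real^3" where "f A = (\<chi> i. if i \<in> A then cube_coord else - cube_coord)" for A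
  have pos: "cube_coord > 0" using cube_coord(1) by linarith
  have range: "cube_directions = range f"
  proof (intro set_eqI iffI)
    fix u :: "real^3" assume u: "u \<in> cube_directions"
    have "u $ i = f {i. u $ i > 0} $ i" for i
      using cube_directions_coord(1)[OF u, of i] pos by (auto simp: f_def)
    then have "u = f {i. u $ i > 0}" unfolding vec_eq_iff by blast
    then show "u \<in> range f" by blast
  qed (use pos in \<open>auto simp: cube_directions_def f_def\<close>)
  have "inj f"
  proof (rule injI)
    fix A B :: "3 set" assume e: "f A = f B"
    have "i \<in> A \<longleftrightarrow> i \<in> B" for i
    proof -
      have "f A $ i = f B $ i" using e by simp
      then show ?thesis using pos by (auto simp: f_def split: if_splits)
    qed
    then show "A = B" by blast
  qed
  have "card cube_directions = card (Pow (UNIV :: 3 set))"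
    unfolding range Pow_UNIV by (rule card_image[OF \<open>inj f\<close>])
  then show "card cube_directions = 8" by (simp only: card_Pow[OF finite]) simp
  show "finite cube_directions" unfolding range by simp
qed

text \<open>The strict bound on \<open>n \<bullet> u\<close> places the center of the cap farther than \<open>pi/6\<close> from the great circle.
  Therefore the great circles of the cube packing miss the whole closed caps, not only their
  interiors.\<close>
lemma cap_side:
  assumes y: "y \<in> cap u (pi/6)" and "u \<in> S2" "n \<in> S2" "n \<bullet> u > 1/2"
  shows "n \<bullet> y > 0"
proof (rule ccontr)
  assume "\<not> n \<bullet> y > 0"
  have unit: "u \<bullet> u = 1" "n \<bullet> n = 1" "norm y = 1" using assms by (auto simp: dot_square_norm cap_def)
  define w where "w = u - (n \<bullet> u) *\<^sub>R n"
  have "(norm w)\<^sup>2 = 1 - (n \<bullet> u)\<^sup>2"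
    unfolding power2_norm_eq_inner w_def using unit
    by (simp add: inner_diff inner_commute[of u n] power2_eq_square)
  moreover have "(n \<bullet> u)\<^sup>2 > (1/2)\<^sup>2" using assms(4) by (intro power_strict_mono) auto
  ultimately have "(norm w)\<^sup>2 < (sqrt 3 / 2)\<^sup>2" by (simp add: power_divide)
  then have "norm w < sqrt 3 / 2" by (rule power2_less_imp_less) simp
  moreover have "y \<bullet> w \<le> norm w" using norm_cauchy_schwarz[of y w] unit by simp
  moreover have "y \<bullet> u = y \<bullet> w + (n \<bullet> u) * (n \<bullet> y)" by (simp add: w_def inner_diff_right inner_commute[of y n])
  moreover have "(n \<bullet> u) * (n \<bullet> y) \<le> 0" using \<open>\<not> n \<bullet> y > 0\<close> assms(4) by (simp add: mult_le_0_iff)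
  moreover have "y \<bullet> u \<ge> sqrt 3 / 2" using y by (simp add: cap_def cos_30)
  ultimately show False by linarith
qed

lemma TS_packing_cube_caps: "TS_packing ((\<lambda>u. cap u (pi/6)) ` cube_directions)"
  unfolding TS_packing_def
proof (intro conjI ballI impI)
  let ?c = "\<lambda>u. cap u (pi/6)"
  fix C assume "C \<in> ?c ` cube_directions"
  then have "spherical_cap (pi/6) C" using cube_directions_unit by (auto simp: spherical_cap_def)
  then show "\<exists>r. 0 < r \<and> r < pi \<and> spherical_cap r C" by (intro exI[of _ "pi/6"]) simp
next
  let ?c = "\<lambda>u. cap u (pi/6)"
  fix A B assume "A \<in> ?c ` cube_directions" "B \<in> ?c ` cube_directions" "A \<noteq> B"
  then obtain u v where uv: "u \<in> cube_directions" "v \<in> cube_directions" "u \<noteq> v" "A = ?c u" "B = ?c v" by blast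
  obtain n where n: "n \<in> S2" "n \<bullet> u > 1/2" "- n \<bullet> v > 1/2"
    "\<And>w. w \<in> cube_directions \<Longrightarrow> n \<bullet> w > 1/2 \<or> - n \<bullet> w > 1/2"
    using cube_directions_separated[OF uv(1-3)] by metis
  have n': "- n \<in> S2" using n(1) by simp
  have unit: "w \<in> S2" if "w \<in> cube_directions" for w using that cube_directions_unit by blast
  have "separated_by n A B"
    unfolding separated_by_def uv(4,5)
    using cap_side[OF _ unit[OF uv(1)] n(1,2)] cap_side[OF _ unit[OF uv(2)] n' n(3)]
    by (auto intro: less_imp_le)
  moreover have "great_circle n \<inter> (top_of_set S2 interior_of C) = {}" if C: "C \<in> ?c ` cube_directions" for C
  proof -
    obtain w where w: "w \<in> cube_directions" "C = ?c w" using C by blast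
    have "n \<bullet> y \<noteq> 0" if "y \<in> C" for y
      using n(4)[OF w(1)] cap_side[OF _ unit[OF w(1)] n(1), of y] cap_side[OF _ unit[OF w(1)] n', of y] that w(2)
      by auto
    moreover have "top_of_set S2 interior_of C \<subseteq> C" by (rule interior_of_subset)
    ultimately show ?thesis by (auto simp: great_circle_def origin_plane_def)
  qed
  moreover have "n \<noteq> 0" using n(1) by auto
  ultimately show "\<exists>n. n \<noteq> 0 \<and> separated_by n A B \<and>
      (\<forall>C\<in>?c ` cube_directions. great_circle n \<inter> (top_of_set S2 interior_of C) = {})" by blast
qed

definition octahedron_vertices :: "(real^3) set" where
  "octahedron_vertices = {axis 1 1, - axis 1 1, axis 2 1, - axis 2 1, axis 3 1, - axis 3 1}"

lemma products_zero_of_sign_sums: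
  fixes x y z :: real
  assumes "x * x + y * y + z * z = 1" "(x + y + z)\<^sup>2 = 1" "(x + y - z)\<^sup>2 = 1" "(x - y + z)\<^sup>2 = 1"
    "(y - x + z)\<^sup>2 = 1"
  shows "x * y = 0" "x * z = 0" "y * z = 0"
  using assms by algebra+

text \<open>This and \<open>cube_directions_iff_octahedron\<close> describe the vertices of each solid by inner products with
  the other one, so an orthogonal map that preserves one of the solids preserves both.\<close>
lemma octahedron_vertices_iff_cube:
  "octahedron_vertices = {e \<in> S2. \<forall>u\<in>cube_directions. (e \<bullet> u)\<^sup>2 = 1/3}"
proof (intro set_eqI iffI)
  fix e assume "e \<in> octahedron_vertices"
  then obtain i where "e = axis i 1 \<or> e = - axis i 1" by (auto simp: octahedron_vertices_def)
  then show "e \<in> {e \<in> S2. \<forall>u\<in>cube_directions. (e \<bullet> u)\<^sup>2 = 1/3}"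
    using cube_directions_coord(2)[of _ i] by (auto simp: axis_inner power2_eq_square)
next
  fix e :: "real^3" assume e: "e \<in> {e \<in> S2. \<forall>u\<in>cube_directions. (e \<bullet> u)\<^sup>2 = 1/3}"
  have unit: "e $ 1 * e $ 1 + e $ 2 * e $ 2 + e $ 3 * e $ 3 = 1"
    using e by (simp add: norm_eq_1 inner_vec_def sum_3)
  have sgn: "(s * e $ 1 + t * e $ 2 + r * e $ 3)\<^sup>2 = 1" if "\<bar>s\<bar> = 1" "\<bar>t\<bar> = 1" "\<bar>r\<bar> = 1" for s t r
  proof -
    define u :: "real^3" where "u = (\<chi> i. cube_coord * (if i = 1 then s else if i = 2 then t else r))"
    have "u \<in> cube_directions" using that cube_coord(1) by (auto simp: u_def cube_directions_def abs_mult)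
    then have "(e \<bullet> u)\<^sup>2 = 1/3" using e by blast
    moreover have "e \<bullet> u = cube_coord * (s * e $ 1 + t * e $ 2 + r * e $ 3)"
      by (simp add: u_def inner_vec_def sum_3 algebra_simps)
    ultimately show ?thesis using cube_coord(2) by (simp add: power_mult_distrib power2_eq_square[of cube_coord])
  qed
  have prods: "e $ 1 * e $ 2 = 0" "e $ 1 * e $ 3 = 0" "e $ 2 * e $ 3 = 0"
    using products_zero_of_sign_sums[OF unit] sgn[of 1 1 1] sgn[of 1 1 "-1"] sgn[of 1 "-1" 1] sgn[of "-1" 1 1]
    by simp_all
  have axes: "e \<in> octahedron_vertices" if "e $ i = 1 \<or> e $ i = - 1" "\<And>j. j \<noteq> i \<Longrightarrow> e $ j = 0" for i
  proof -
    have "e = axis i 1 \<or> e = - axis i 1" using that by (auto simp: vec_eq_iff axis_def)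
    then show ?thesis using exhaust_3[of i] by (auto simp: octahedron_vertices_def)
  qed
  have one: "x = 1 \<or> x = - 1" if "x * x = 1" for x :: real using that by (simp add: square_eq_1_iff)
  consider "e $ 1 \<noteq> 0" | "e $ 2 \<noteq> 0" | "e $ 3 \<noteq> 0" using unit by fastforce
  then show "e \<in> octahedron_vertices"
  proof cases
    case 1
    then have z: "e $ 2 = 0" "e $ 3 = 0" using prods by auto
    show ?thesis
    proof (rule axes[of 1])
      show "e $ j = 0" if "j \<noteq> 1" for j using that z exhaust_3[of j] by auto
    qed (use unit z in \<open>auto intro!: one\<close>)
  next
    case 2
    then have z: "e $ 1 = 0" "e $ 3 = 0" using prods by auto
    show ?thesis
    proof (rule axes[of 2])
      show "e $ j = 0" if "j \<noteq> 2" for j using that z exhaust_3[of j] by auto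
    qed (use unit z in \<open>auto intro!: one\<close>)
  next
    case 3
    then have z: "e $ 1 = 0" "e $ 2 = 0" using prods by auto
    show ?thesis
    proof (rule axes[of 3])
      show "e $ j = 0" if "j \<noteq> 3" for j using that z exhaust_3[of j] by auto
    qed (use unit z in \<open>auto intro!: one\<close>)
  qed
qed

text \<open>The polar of the octahedron is a cube, and its points on the sphere are its vertices: if all
  coordinates of a unit vector are at most \<open>cube_coord\<close> in absolute value, then all are equal to it.\<close>
lemma cube_directions_iff_octahedron:
  "cube_directions = {u \<in> S2. \<forall>q\<in>convex hull octahedron_vertices. u \<bullet> q \<le> cube_coord}"
proof (intro set_eqI iffI)
  fix u assume u: "u \<in> cube_directions"
  have "octahedron_vertices \<subseteq> {q. u \<bullet> q \<le> cube_coord}"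
    using cube_directions_coord(1)[OF u] cube_coord(1)
    by (auto simp: octahedron_vertices_def inner_commute[of u] axis_inner) (smt (verit))+
  then have "convex hull octahedron_vertices \<subseteq> {q. u \<bullet> q \<le> cube_coord}"
    by (intro hull_minimal convex_halfspace_le)
  then show "u \<in> {u \<in> S2. \<forall>q\<in>convex hull octahedron_vertices. u \<bullet> q \<le> cube_coord}"
    using u cube_directions_unit by blast
next
  fix u :: "real^3" assume u: "u \<in> {u \<in> S2. \<forall>q\<in>convex hull octahedron_vertices. u \<bullet> q \<le> cube_coord}"
  have unit: "u $ 1 * u $ 1 + u $ 2 * u $ 2 + u $ 3 * u $ 3 = 1"
    using u by (simp add: norm_eq_1 inner_vec_def sum_3)
  have le: "\<bar>u $ i\<bar> \<le> cube_coord" for i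
  proof -
    have "axis i 1 \<in> octahedron_vertices" "- axis i 1 \<in> octahedron_vertices"
      using exhaust_3[of i] by (auto simp: octahedron_vertices_def)
    then have "axis i 1 \<in> convex hull octahedron_vertices" "- axis i 1 \<in> convex hull octahedron_vertices"
      by (simp_all add: hull_inc)
    then have "u \<bullet> axis i 1 \<le> cube_coord" "u \<bullet> - axis i 1 \<le> cube_coord"
      using u by blast+
    then show ?thesis by (simp add: inner_commute[of u] axis_inner abs_le_iff)
  qed
  have sq: "u $ i * u $ i \<le> 1/3" for i
    using mult_mono[OF le le, of i i] cube_coord by simp
  have "u $ i * u $ i = 1/3" for i
    using exhaust_3[of i] unit sq[of 1] sq[of 2] sq[of 3] by auto
  then have "\<bar>u $ i\<bar> * \<bar>u $ i\<bar> = cube_coord * cube_coord" for i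
    by (simp only: abs_mult_self_eq cube_coord(2))
  then have "\<bar>u $ i\<bar> = cube_coord" for i
    using cube_coord(1) unfolding square_eq_iff by (smt (verit) half_gt_zero)
  then show "u \<in> cube_directions" by (simp add: cube_directions_def)
qed

lemma orthogonal_image_of_inner_characterized:
  assumes T: "orthogonal_transformation T" and B: "T ` B = B"
    and A: "A = {x \<in> S2. \<forall>b\<in>B. \<phi> (x \<bullet> b)}"
  shows "T ` A = A"
proof -
  have iff: "T x \<in> A \<longleftrightarrow> x \<in> A" for x
  proof -
    have "(\<forall>b\<in>B. \<phi> (T x \<bullet> b)) \<longleftrightarrow> (\<forall>b\<in>B. \<phi> (T x \<bullet> T b))" using B by (metis imageE imageI)
    then show ?thesis using T unfolding A by (simp add: orthogonal_transformation_norm orthogonal_transformation_def)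
  qed
  have "y \<in> T ` A" if "y \<in> A" for y
  proof -
    obtain x where "y = T x" using orthogonal_transformation_surj[OF T] by (metis surjD)
    then show ?thesis using that iff by blast
  qed
  then show ?thesis using iff by blast
qed

lemma orthogonal_image_cap:
  assumes "orthogonal_transformation T"
  shows "T ` cap u r = cap (T u) r"
proof -
  have iff: "T y \<in> cap (T u) r \<longleftrightarrow> y \<in> cap u r" for y
    using assms by (simp add: cap_def orthogonal_transformation_norm orthogonal_transformation_def)
  have "y \<in> T ` cap u r" if "y \<in> cap (T u) r" for y
  proof -
    obtain x where "y = T x" using orthogonal_transformation_surj[OF assms] by (metis surjD)
    then show ?thesis using that iff by blast
  qed
  then show ?thesis using iff by blast
qed

lemma inj_on_cap: "inj_on (\<lambda>u. cap u (pi/6)) S2"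
  using cap_center_unique[of _ _ "pi/6"] by (auto simp: inj_on_def cos_30)

text \<open>An orthogonal map permutes the caps if and only if it permutes their centers, because a cap
  determines its center.\<close>
lemma octahedral_symmetry_cube_caps: "octahedral_symmetry ((\<lambda>u. cap u (pi/6)) ` cube_directions)"
proof -
  let ?c = "\<lambda>u. cap u (pi/6)" and ?Q = "convex hull octahedron_vertices"
  have oct: "regular_octahedron ?Q"
    unfolding regular_octahedron_def octahedron_vertices_def
  proof (intro exI conjI)
    show "axis 1 1 \<noteq> (0 :: real^3)" by (simp add: axis_eq_0_iff)
    show "orthogonal (axis 1 1) (axis 2 1 :: real^3)" "orthogonal (axis 2 1) (axis 3 1 :: real^3)"
      "orthogonal (axis 3 1) (axis 1 1 :: real^3)"
      unfolding orthogonal_def axis_inner by (simp_all add: axis_def)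
  qed (simp_all)
  have key: "(\<lambda>C. T ` C) ` (?c ` cube_directions) = ?c ` cube_directions \<longleftrightarrow> T ` ?Q = ?Q"
    if T: "orthogonal_transformation T" for T
  proof -
    have "(\<lambda>C. T ` C) ` (?c ` cube_directions) = ?c ` (T ` cube_directions)"
      using orthogonal_image_cap[OF T] by (simp add: image_image)
    moreover have "T ` cube_directions \<subseteq> S2"
      using cube_directions_unit T by (auto simp: orthogonal_transformation_norm)
    ultimately have "(\<lambda>C. T ` C) ` (?c ` cube_directions) = ?c ` cube_directions \<longleftrightarrow>
        T ` cube_directions = cube_directions"
      using inj_on_image_eq_iff[OF inj_on_cap _ cube_directions_unit] by simp
    also have "\<dots> \<longleftrightarrow> T ` ?Q = ?Q"
    proof
      assume "T ` cube_directions = cube_directions"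
      then have "T ` octahedron_vertices = octahedron_vertices"
        by (rule orthogonal_image_of_inner_characterized[OF T _ octahedron_vertices_iff_cube])
      then show "T ` ?Q = ?Q"
        using convex_hull_linear_image[of T octahedron_vertices] T by (simp add: orthogonal_transformation_def)
    next
      assume "T ` ?Q = ?Q"
      then show "T ` cube_directions = cube_directions"
        by (rule orthogonal_image_of_inner_characterized[OF T _ cube_directions_iff_octahedron])
    qed
    finally show ?thesis .
  qed
  show ?thesis
    unfolding octahedral_symmetry_def by (intro exI[of _ ?Q] conjI oct Collect_cong conj_cong refl key)
qed

section \<open>The centered separable kissing number\<close>

theorem theorem3:
  shows "tau_csep = 8 \<and>
    (\<exists>P F. centered_separable_packing P \<and> card P = 8 \<and>
       F = central_projection ` P \<and> card F = 8 \<and>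
       TS_packing F \<and> (\<forall>C\<in>F. spherical_cap (pi/6) C) \<and>
       octahedral_symmetry F)"
proof -
  let ?ball = "\<lambda>u::real^3. cball (2 *\<^sub>R u) 1" and ?cap = "\<lambda>u. cap u (pi/6)"
  let ?P = "?ball ` cube_directions" and ?F = "?cap ` cube_directions"
  have P: "centered_separable_packing ?P"
    by (rule packing_of_directions[OF separable_cube_directions])
  have card_P: "card ?P = 8" using card_image[OF inj_cball] card_cube_directions(2) by simp
  have "central_projection (?ball u) = ?cap u" if "u \<in> cube_directions" for u
    using that cube_directions_unit by (intro central_projection_ball) auto
  then have F: "?F = central_projection ` ?P" by (auto simp: image_image)
  have card_F: "card ?F = 8"
    using card_image[OF inj_on_subset[OF inj_on_cap cube_directions_unit]] card_cube_directions(2) by simp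
  have caps: "\<forall>C\<in>?F. spherical_cap (pi/6) C"
    using cube_directions_unit by (auto simp: spherical_cap_def)
  have "ecard Q \<le> 8" if Q: "centered_separable_packing Q" for Q
  proof -
    obtain U where U: "separable_directions U" "Q = ?ball ` U" using packing_directions[OF Q] .
    then have "finite U" "card U \<le> 8" using separable_directions_le_8 by auto
    then have "finite Q" "card Q \<le> 8" using U(2) card_image_le[of U ?ball] by auto
    then show ?thesis by (simp add: ecard_def numeral_eq_enat)
  qed
  moreover have "ecard ?P = 8"
    using card_P card_cube_directions(1) by (simp add: ecard_def numeral_eq_enat)
  ultimately have "tau_csep = 8"
    unfolding tau_csep_def using P by (intro antisym SUP_least) (auto intro: SUP_upper2)
  then show ?thesis
    using P card_P F card_F TS_packing_cube_caps caps octahedral_symmetry_cube_caps by metis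
qed

end
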